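(* Let $F\colon\mathcal I\to\mathrm{Cat}$ be a small diagram of small categories. Then each morphism in $(\operatorname{colim}F)(a,b)$ between $a,b\in\operatorname{colim}(\mathrm{Ob}\circ F)$ is uniquely represented by an equivalence class of non-empty strings $[(i_n,\alpha_n),\dots,(i_1,\alpha_1)]$ where $$\alpha_k\in\operatorname{mor}F(i_k),\quad \operatorname{cod}(\alpha_{k-1})\sim\operatorname{dom}(\alpha_k),\quad\operatorname{cod}(\alpha_n)\in b,\quad\operatorname{dom}(\alpha_1)\in a.$$ The equivalence relation on strings is generated by composition of consecutive morphisms in the same $F(i)$, $$[\dots,(i,\beta),(i,\alpha),\dots]\sim[\dots,(i,\beta\circ\alpha),\dots]\quad(\text{for }\beta,\alpha\text{ composable in }F(i)),$$ and by edgewise transports along morphisms $f\colon i\to j$ in $\mathcal I$, $$[\dots,(i,\alpha),\dots]\sim[\dots,(j,(Ff)(\alpha)),\dots].$$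
   Context: $\mathrm{Cat}$ is the category of small categories, $\mathrm{Ob}\colon\mathrm{Cat}\to\mathrm{Set}$ the object-set functor; the set of objects of $\operatorname{colim}F$ is $\operatorname{colim}(\mathrm{Ob}\circ F)$, whose elements are equivalence classes of objects of the categories $F(i)$. For objects $x\in F(i)$, $y\in F(j)$, $x\sim y$ means they have the same class in $\operatorname{colim}(\mathrm{Ob}\circ F)$, and $x\in a$ means the class of $x$ is $a$. A string $[(i_n,\alpha_n),\dots,(i_1,\alpha_1)]$ represents the composite $\iota_{i_n}(\alpha_n)\circ\cdots\circ\iota_{i_1}(\alpha_1)$ in $\operatorname{colim}F$, where $\iota_i\colon F(i)\to\operatorname{colim}F$ is the colimiting cocone; "uniquely represented" means that this gives a bijection between equivalence classes of such strings and $(\operatorname{colim}F)(a,b)$. *)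

theory Defs
  imports Main
begin

record ('o, 'm) cat =
  Ob :: "'o set"
  Mor :: "'m set"
  Dom :: "'m \<Rightarrow> 'o"
  Cod :: "'m \<Rightarrow> 'o"
  ident :: "'o \<Rightarrow> 'm"
  Comp :: "'m \<Rightarrow> 'm \<Rightarrow> 'm"

text \<open>The value \<open>Comp C g f\<close> is the composite g after f; it is only meaningful
  when \<open>Cod C f = Dom C g\<close>.\<close>

definition Hom :: "('o, 'm) cat \<Rightarrow> 'o \<Rightarrow> 'o \<Rightarrow> 'm set" where
  "Hom C x y = {f \<in> Mor C. Dom C f = x \<and> Cod C f = y}"

locale category =
  fixes C :: "('o, 'm) cat"
  assumes Dom_in: "f \<in> Mor C \<Longrightarrow> Dom C f \<in> Ob C"
    and Cod_in: "f \<in> Mor C \<Longrightarrow> Cod C f \<in> Ob C"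
    and ident_in: "x \<in> Ob C \<Longrightarrow> ident C x \<in> Hom C x x"
    and Comp_in: "\<lbrakk>f \<in> Hom C x y; g \<in> Hom C y z\<rbrakk> \<Longrightarrow> Comp C g f \<in> Hom C x z"
    and Comp_ident_left: "f \<in> Hom C x y \<Longrightarrow> Comp C (ident C y) f = f"
    and Comp_ident_right: "f \<in> Hom C x y \<Longrightarrow> Comp C f (ident C x) = f"
    and Comp_assoc: "\<lbrakk>f \<in> Hom C w x; g \<in> Hom C x y; h \<in> Hom C y z\<rbrakk>
      \<Longrightarrow> Comp C (Comp C h g) f = Comp C h (Comp C g f)"

record ('o, 'm, 'p, 'q) ftr =
  omap :: "'o \<Rightarrow> 'p"
  mmap :: "'m \<Rightarrow> 'q"

locale cat_functor = C: category C + D: category D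
  for C :: "('o, 'm) cat" and D :: "('p, 'q) cat" +
  fixes H :: "('o, 'm, 'p, 'q) ftr"
  assumes omap_in: "x \<in> Ob C \<Longrightarrow> omap H x \<in> Ob D"
    and mmap_in: "f \<in> Hom C x y \<Longrightarrow> mmap H f \<in> Hom D (omap H x) (omap H y)"
    and mmap_ident: "x \<in> Ob C \<Longrightarrow> mmap H (ident C x) = ident D (omap H x)"
    and mmap_Comp: "\<lbrakk>f \<in> Hom C x y; g \<in> Hom C y z\<rbrakk>
      \<Longrightarrow> mmap H (Comp C g f) = Comp D (mmap H g) (mmap H f)"

definition ftr_id :: "('o, 'm, 'o, 'm) ftr" where
  "ftr_id = \<lparr>omap = (\<lambda>x. x), mmap = (\<lambda>f. f)\<rparr>"

definition ftr_comp ::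
  "('p, 'q, 'r, 's) ftr \<Rightarrow> ('o, 'm, 'p, 'q) ftr \<Rightarrow> ('o, 'm, 'r, 's) ftr" where
  "ftr_comp K H = \<lparr>omap = omap K \<circ> omap H, mmap = mmap K \<circ> mmap H\<rparr>"

text \<open>Equality of functors with source \<open>C\<close>: the underlying total functions are only
  compared on the objects and morphisms of \<open>C\<close>.\<close>

definition ftr_eq :: "('o, 'm) cat \<Rightarrow> ('o, 'm, 'p, 'q) ftr \<Rightarrow> ('o, 'm, 'p, 'q) ftr \<Rightarrow> bool" where
  "ftr_eq C H K \<longleftrightarrow>
    (\<forall>x\<in>Ob C. omap H x = omap K x) \<and> (\<forall>f\<in>Mor C. mmap H f = mmap K f)"

text \<open>A diagram of categories indexed by \<open>I\<close>: \<open>F i\<close> is the category at the object \<open>i\<close>,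
  and \<open>T f\<close> is the functor at the morphism \<open>f\<close>.\<close>

locale cat_diagram = I: category I
  for I :: "('i, 'j) cat" +
  fixes F :: "'i \<Rightarrow> ('o, 'm) cat"
    and T :: "'j \<Rightarrow> ('o, 'm, 'o, 'm) ftr"
  assumes F_category: "i \<in> Ob I \<Longrightarrow> category (F i)"
    and T_functor: "f \<in> Hom I i j \<Longrightarrow> cat_functor (F i) (F j) (T f)"
    and T_ident: "i \<in> Ob I \<Longrightarrow> ftr_eq (F i) (T (ident I i)) ftr_id"
    and T_Comp: "\<lbrakk>f \<in> Hom I i j; g \<in> Hom I j k\<rbrakk>
      \<Longrightarrow> ftr_eq (F i) (T (Comp I g f)) (ftr_comp (T g) (T f))"

locale cat_cocone = cat_diagram I F T + C: category C
  for I :: "('i, 'j) cat"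
    and F :: "'i \<Rightarrow> ('o, 'm) cat"
    and T :: "'j \<Rightarrow> ('o, 'm, 'o, 'm) ftr"
    and C :: "('p, 'q) cat" +
  fixes \<iota> :: "'i \<Rightarrow> ('o, 'm, 'p, 'q) ftr"
  assumes leg_functor: "i \<in> Ob I \<Longrightarrow> cat_functor (F i) C (\<iota> i)"
    and leg_natural: "f \<in> Hom I i j \<Longrightarrow> ftr_eq (F i) (ftr_comp (\<iota> j) (T f)) (\<iota> i)"

text \<open>Colimits in Cat, by the universal property. A type \<open>'u\<close> plays the role of the universe
  of smallness: a small category is one whose objects and morphisms form sets of elements of
  \<open>'u\<close>, and the index category, the categories of the diagram, the colimit and the test
  categories \<open>D\<close> are all small in this sense. If \<open>'u\<close> is infinite, such colimits exist and
  are colimits against categories over any other types as well, since the objects of a colimit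
  are classes of pairs of elements of \<open>'u\<close> and its morphisms are classes of finite lists of
  such pairs. Over a finite \<open>'u\<close> there would be too few test categories.\<close>

definition is_colimit ::
  "('u, 'u) cat \<Rightarrow> ('u \<Rightarrow> ('u, 'u) cat) \<Rightarrow> ('u \<Rightarrow> ('u, 'u, 'u, 'u) ftr)
    \<Rightarrow> ('u, 'u) cat \<Rightarrow> ('u \<Rightarrow> ('u, 'u, 'u, 'u) ftr) \<Rightarrow> bool" where
  "is_colimit I F T C \<iota> \<longleftrightarrow>
    cat_cocone I F T C \<iota> \<and>
    (\<forall>(D :: ('u, 'u) cat) \<kappa>. cat_cocone I F T D \<kappa> \<longrightarrow>
      (\<exists>H. cat_functor C D H \<and>
        (\<forall>i\<in>Ob I. ftr_eq (F i) (ftr_comp H (\<iota> i)) (\<kappa> i)) \<and>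
        (\<forall>K. cat_functor C D K \<and> (\<forall>i\<in>Ob I. ftr_eq (F i) (ftr_comp K (\<iota> i)) (\<kappa> i))
          \<longrightarrow> ftr_eq C K H)))"

definition generated_equiv :: "'a set \<Rightarrow> ('a \<times> 'a) set \<Rightarrow> ('a \<times> 'a) set" where
  "generated_equiv A r = (Restr r A \<union> (Restr r A)\<inverse>)\<^sup>* \<inter> A \<times> A"

text \<open>The colimit of the sets of objects, constructed as the quotient of their disjoint union.\<close>

definition ob_elements :: "('i, 'j) cat \<Rightarrow> ('i \<Rightarrow> ('o, 'm) cat) \<Rightarrow> ('i \<times> 'o) set" where
  "ob_elements I F = (SIGMA i:Ob I. Ob (F i))"

definition ob_equiv ::
  "('i, 'j) cat \<Rightarrow> ('i \<Rightarrow> ('o, 'm) cat) \<Rightarrow> ('j \<Rightarrow> ('o, 'm, 'o, 'm) ftr)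
    \<Rightarrow> (('i \<times> 'o) \<times> ('i \<times> 'o)) set" where
  "ob_equiv I F T = generated_equiv (ob_elements I F)
    {((i, x), (j, omap (T f) x)) | i j f x. f \<in> Hom I i j \<and> x \<in> Ob (F i)}"

definition colim_Ob ::
  "('i, 'j) cat \<Rightarrow> ('i \<Rightarrow> ('o, 'm) cat) \<Rightarrow> ('j \<Rightarrow> ('o, 'm, 'o, 'm) ftr)
    \<Rightarrow> ('i \<times> 'o) set set" where
  "colim_Ob I F T = ob_elements I F // ob_equiv I F T"

text \<open>The object of the vertex of a cocone determined by a class of objects: the common image
  of the members of the class under the legs.\<close>

definition class_ob :: "('i \<Rightarrow> ('o, 'm, 'p, 'q) ftr) \<Rightarrow> ('i \<times> 'o) set \<Rightarrow> 'p" where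
  "class_ob \<iota> a = the_elem ((\<lambda>(i, x). omap (\<iota> i) x) ` a)"

text \<open>A string is a list in the order of composition: its head is \<open>(i\<^sub>n, \<alpha>\<^sub>n)\<close>, the morphism
  applied last, and its last entry is \<open>(i\<^sub>1, \<alpha>\<^sub>1)\<close>.\<close>

definition strings ::
  "('i, 'j) cat \<Rightarrow> ('i \<Rightarrow> ('o, 'm) cat) \<Rightarrow> ('j \<Rightarrow> ('o, 'm, 'o, 'm) ftr)
    \<Rightarrow> ('i \<times> 'o) set \<Rightarrow> ('i \<times> 'o) set \<Rightarrow> ('i \<times> 'm) list set" where
  "strings I F T a b = {s. s \<noteq> [] \<and>
    (\<forall>(i, \<alpha>)\<in>set s. i \<in> Ob I \<and> \<alpha> \<in> Mor (F i)) \<and>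
    (\<forall>k. Suc k < length s \<longrightarrow>
      (case (s ! k, s ! Suc k) of ((j, \<beta>), (i, \<alpha>)) \<Rightarrow>
        ((i, Cod (F i) \<alpha>), (j, Dom (F j) \<beta>)) \<in> ob_equiv I F T)) \<and>
    (case hd s of (i, \<alpha>) \<Rightarrow> (i, Cod (F i) \<alpha>) \<in> b) \<and>
    (case last s of (i, \<alpha>) \<Rightarrow> (i, Dom (F i) \<alpha>) \<in> a)}"

definition comp_step ::
  "('i, 'j) cat \<Rightarrow> ('i \<Rightarrow> ('o, 'm) cat) \<Rightarrow> (('i \<times> 'm) list \<times> ('i \<times> 'm) list) set" where
  "comp_step I F =
    {(p @ [(i, \<beta>), (i, \<alpha>)] @ q, p @ [(i, Comp (F i) \<beta> \<alpha>)] @ q) | p q i \<alpha> \<beta>.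
      i \<in> Ob I \<and> \<alpha> \<in> Mor (F i) \<and> \<beta> \<in> Mor (F i) \<and> Cod (F i) \<alpha> = Dom (F i) \<beta>}"

definition transport_step ::
  "('i, 'j) cat \<Rightarrow> ('i \<Rightarrow> ('o, 'm) cat) \<Rightarrow> ('j \<Rightarrow> ('o, 'm, 'o, 'm) ftr)
    \<Rightarrow> (('i \<times> 'm) list \<times> ('i \<times> 'm) list) set" where
  "transport_step I F T =
    {(p @ [(i, \<alpha>)] @ q, p @ [(j, mmap (T f) \<alpha>)] @ q) | p q i j f \<alpha>.
      f \<in> Hom I i j \<and> \<alpha> \<in> Mor (F i)}"

definition string_equiv ::
  "('i, 'j) cat \<Rightarrow> ('i \<Rightarrow> ('o, 'm) cat) \<Rightarrow> ('j \<Rightarrow> ('o, 'm, 'o, 'm) ftr)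
    \<Rightarrow> ('i \<times> 'o) set \<Rightarrow> ('i \<times> 'o) set \<Rightarrow> (('i \<times> 'm) list \<times> ('i \<times> 'm) list) set" where
  "string_equiv I F T a b =
    generated_equiv (strings I F T a b) (comp_step I F \<union> transport_step I F T)"

text \<open>The composite in \<open>C\<close> represented by a string; the value on the empty list is junk.\<close>

fun string_value ::
  "('p, 'q) cat \<Rightarrow> ('i \<Rightarrow> ('o, 'm, 'p, 'q) ftr) \<Rightarrow> ('i \<times> 'm) list \<Rightarrow> 'q" where
  "string_value C \<iota> [] = undefined"
| "string_value C \<iota> [(i, \<alpha>)] = mmap (\<iota> i) \<alpha>"
| "string_value C \<iota> ((i, \<alpha>) # t # s) = Comp C (mmap (\<iota> i) \<alpha>) (string_value C \<iota> (t # s))"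

text \<open>The map on classes of strings induced by \<^const>\<open>string_value\<close>; it is meaningful when
  \<^const>\<open>string_value\<close> is constant on the class.\<close>

definition class_value ::
  "('p, 'q) cat \<Rightarrow> ('i \<Rightarrow> ('o, 'm, 'p, 'q) ftr) \<Rightarrow> ('i \<times> 'm) list set \<Rightarrow> 'q" where
  "class_value C \<iota> S = the_elem (string_value C \<iota> ` S)"

end

theory Submission
  imports Defs
begin

text \<open>The classes of strings form a category: composition is concatenation, and the identity of
  the class of \<open>(i, x)\<close> is the class of the one-letter string on the identity of \<open>x\<close>, which does not
  depend on the representative because transports preserve identities. The string relation is
  exactly what makes the evaluation of strings along an arbitrary cocone well defined, so this
  category has the universal property of the colimit, against test categories over any types.
  Hence every colimit is isomorphic to it, by evaluation of strings.\<close>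

section \<open>Functors and generated equivalences\<close>

text \<open>That strings with the same value are equivalent is not proved by rewriting: no normal
  forms and no confluence of the two kinds of moves are involved. The universal property of a
  colimit \<open>C\<close> yields a functor from \<open>C\<close> back to \<open>string_cat\<close>,
  and this functor reads off the class of a string from its value. Two features shape the details.
  Neighbouring letters of a string have ends that agree only up to \<open>ob_equiv\<close>, whereas
  a composition move asks for strict composability inside one \<open>F i\<close>; the identity laws
  therefore depend on choosing the right representative of an identity. And
  \<open>is_colimit\<close> tests only against categories over \<open>'u\<close>, while the objects
  and morphisms of \<open>string_cat\<close> are sets and triples of sets. Since \<open>'u\<close>
  is infinite, finite lists of pairs can be coded in \<open>'u\<close>, so there is a copy of
  \<open>string_cat\<close> over \<open>'u\<close>; it serves both as a colimit and as a test
  category.\<close>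

lemma Hom_iff: "f \<in> Hom C x y \<longleftrightarrow> f \<in> Mor C \<and> Dom C f = x \<and> Cod C f = y"
  by (simp add: Hom_def)

lemma Mor_in_Hom: "f \<in> Mor C \<Longrightarrow> f \<in> Hom C (Dom C f) (Cod C f)"
  by (simp add: Hom_def)

lemma ftr_comp_simps [simp]:
  "omap (ftr_comp K H) x = omap K (omap H x)"
  "mmap (ftr_comp K H) f = mmap K (mmap H f)"
  by (simp_all add: ftr_comp_def)

lemma cat_functor_comp:
  assumes "cat_functor A B H" "cat_functor B C K"
  shows "cat_functor A C (ftr_comp K H)"
proof -
  interpret H: cat_functor A B H by fact
  interpret K: cat_functor B C K by fact
  show ?thesis
    by unfold_locales
      (auto simp: H.omap_in K.omap_in H.mmap_ident K.mmap_ident H.mmap_Comp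
        intro: H.mmap_in K.mmap_in K.mmap_Comp)
qed

lemma cat_functor_id: "category C \<Longrightarrow> cat_functor C C ftr_id"
  by (simp add: cat_functor_def cat_functor_axioms_def ftr_id_def)

lemma (in cat_functor) mmap_Mor:
  assumes "f \<in> Mor C"
  shows "mmap H f \<in> Mor D" "Dom D (mmap H f) = omap H (Dom C f)"
    "Cod D (mmap H f) = omap H (Cod C f)"
  using mmap_in[OF Mor_in_Hom[OF assms]] by (simp_all add: Hom_iff)

lemma cat_cocone_comp:
  assumes "cat_cocone I F T C \<iota>" "cat_functor C D H"
  shows "cat_cocone I F T D (\<lambda>i. ftr_comp H (\<iota> i))"
proof -
  interpret cat_cocone I F T C \<iota> by fact
  interpret H: cat_functor C D H by fact
  show ?thesis
  proof (intro cat_cocone.intro cat_cocone_axioms.intro cat_diagram_axioms H.D.category_axioms)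
    show "cat_functor (F i) D (ftr_comp H (\<iota> i))" if "i \<in> Ob I" for i
      using cat_functor_comp[OF leg_functor[OF that] assms(2)] .
    show "ftr_eq (F i) (ftr_comp (ftr_comp H (\<iota> j)) (T f)) (ftr_comp H (\<iota> i))"
      if "f \<in> Hom I i j" for f i j
      using leg_natural[OF that] by (simp add: ftr_eq_def)
  qed
qed

section \<open>Equivalence relations generated by steps\<close>

lemma equiv_generated_equiv: "equiv A (generated_equiv A r)"
proof -
  let ?S = "Restr r A \<union> (Restr r A)\<inverse>"
  have "sym (?S\<^sup>*)"
    by (rule sym_rtrancl) (auto simp: sym_def)
  then have "sym (generated_equiv A r)"
    unfolding generated_equiv_def by (auto simp: sym_def)
  moreover have "refl_on A (generated_equiv A r)"
    unfolding generated_equiv_def by (auto simp: refl_on_def)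
  moreover have "trans (generated_equiv A r)"
    unfolding generated_equiv_def by (auto simp: trans_def intro: rtrancl_trans)
  ultimately show ?thesis
    unfolding equiv_def generated_equiv_def by auto
qed

lemma generated_equivI:
  "(x, y) \<in> r \<Longrightarrow> x \<in> A \<Longrightarrow> y \<in> A \<Longrightarrow> (x, y) \<in> generated_equiv A r"
  by (auto simp: generated_equiv_def)

text \<open>Induction along a zigzag of steps. Both ends of each step may be assumed to lie in
  \<open>A\<close>, because the relation is restricted before it is closed; for strings this
  provides the composability that a single move needs.\<close>

lemma generated_equiv_invariant:
  assumes "(x, y) \<in> generated_equiv A r"
    and step: "\<And>x y. (x, y) \<in> r \<Longrightarrow> x \<in> A \<Longrightarrow> y \<in> A \<Longrightarrow> f x = f y"
  shows "f x = f y"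
proof -
  have "(x, y) \<in> (Restr r A \<union> (Restr r A)\<inverse>)\<^sup>*"
    using assms(1) by (simp add: generated_equiv_def)
  then show ?thesis
    by induction (auto dest: step)
qed

text \<open>The \<open>R\<close>-class of \<open>g x\<close> is an invariant of the steps, which
  reduces the claim to \<open>generated_equiv_invariant\<close>. It serves for concatenation with a
  fixed string.\<close>

lemma generated_equiv_map:
  assumes "(x, y) \<in> generated_equiv A r" and R: "equiv B R"
    and g: "\<And>x. x \<in> A \<Longrightarrow> g x \<in> B"
    and step: "\<And>x y. (x, y) \<in> r \<Longrightarrow> x \<in> A \<Longrightarrow> y \<in> A \<Longrightarrow> (g x, g y) \<in> R"
  shows "(g x, g y) \<in> R"
proof -
  have "R `` {g x} = R `` {g y}"
    using assms(1)
    by (rule generated_equiv_invariant[where f = "\<lambda>x. R `` {g x}"])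
      (intro equiv_class_eq[OF R] step)
  moreover have "g x \<in> B" "g y \<in> B"
    using assms(1) g by (auto simp: generated_equiv_def)
  ultimately show ?thesis
    using R by (simp add: eq_equiv_class_iff)
qed

text \<open>\<open>class_ob\<close> and \<open>class_value\<close> are \<open>the_elem\<close> of an
  image; this evaluates them at any representative once the function is known to be constant on the
  class.\<close>

lemma the_elem_image_constant:
  assumes "x \<in> A" "\<And>y. y \<in> A \<Longrightarrow> f y = f x"
  shows "the_elem (f ` A) = f x"
proof -
  have "f ` A = (\<lambda>_. f x) ` A"
    by (intro image_cong refl assms(2))
  also have "\<dots> = {f x}"
    using assms(1) by auto
  finally show ?thesis by simp
qed

section \<open>Strings\<close>

context cat_diagram
begin

definition ob_class :: "'i \<times> 'o \<Rightarrow> ('i \<times> 'o) set" where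
  "ob_class z = ob_equiv I F T `` {z}"

definition src :: "'i \<times> 'm \<Rightarrow> ('i \<times> 'o) set" where
  "src e = ob_class (fst e, Dom (F (fst e)) (snd e))"

definition tgt :: "'i \<times> 'm \<Rightarrow> ('i \<times> 'o) set" where
  "tgt e = ob_class (fst e, Cod (F (fst e)) (snd e))"

definition entries :: "('i \<times> 'm) set" where
  "entries = (SIGMA i:Ob I. Mor (F i))"

text \<open>The condition of \<open>strings\<close> with free ends and with the object relation
  replaced by equality of classes, so that the ends become functions of the string and composability
  becomes an equation.\<close>

definition chains :: "('i \<times> 'm) list set" where
  "chains = {s. s \<noteq> [] \<and> set s \<subseteq> entries \<and> successively (\<lambda>d e. tgt e = src d) s}"

lemma equiv_ob_equiv: "equiv (ob_elements I F) (ob_equiv I F T)"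
  unfolding ob_equiv_def by (rule equiv_generated_equiv)

lemma ob_equiv_iff:
  assumes "z \<in> ob_elements I F" "w \<in> ob_elements I F"
  shows "(z, w) \<in> ob_equiv I F T \<longleftrightarrow> ob_class z = ob_class w"
  unfolding ob_class_def using eq_equiv_class_iff[OF equiv_ob_equiv assms] by simp

lemma ob_class_in: "z \<in> ob_elements I F \<Longrightarrow> ob_class z \<in> colim_Ob I F T"
  unfolding ob_class_def colim_Ob_def by (rule quotientI)

lemma colim_Ob_cases:
  assumes "a \<in> colim_Ob I F T"
  obtains i x where "i \<in> Ob I" "x \<in> Ob (F i)" "a = ob_class (i, x)"
  using assms unfolding colim_Ob_def ob_class_def ob_elements_def
  by (auto elim!: quotientE)

lemma mem_colim_Ob_iff:
  assumes "a \<in> colim_Ob I F T" "z \<in> ob_elements I F"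
  shows "z \<in> a \<longleftrightarrow> ob_class z = a"
proof -
  obtain w where w: "w \<in> ob_elements I F" "a = ob_class w"
    using assms(1) by (rule colim_Ob_cases) (auto simp: ob_elements_def)
  show ?thesis
    using ob_equiv_iff[OF w(1) assms(2)] w(2) by (auto simp: ob_class_def)
qed

lemma mem_ob_class: "z \<in> ob_elements I F \<Longrightarrow> z \<in> ob_class z"
  using mem_colim_Ob_iff[OF ob_class_in] by blast

lemma ob_class_transport:
  assumes "f \<in> Hom I i j" "x \<in> Ob (F i)"
  shows "ob_class (j, omap (T f) x) = ob_class (i, x)"
proof -
  interpret T: cat_functor "F i" "F j" "T f"
    using assms(1) by (rule T_functor)
  have ij: "i \<in> Ob I" "j \<in> Ob I"
    using assms(1) I.Dom_in I.Cod_in by (auto simp: Hom_iff)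
  have "((i, x), (j, omap (T f) x)) \<in> ob_equiv I F T"
    unfolding ob_equiv_def
    using assms ij T.omap_in by (intro generated_equivI) (auto simp: ob_elements_def)
  then show ?thesis
    unfolding ob_class_def using equiv_class_eq[OF equiv_ob_equiv] by metis
qed

lemma entry_ends:
  assumes "(i, \<alpha>) \<in> entries"
  shows "i \<in> Ob I" "\<alpha> \<in> Mor (F i)" "Dom (F i) \<alpha> \<in> Ob (F i)" "Cod (F i) \<alpha> \<in> Ob (F i)"
    "(i, Dom (F i) \<alpha>) \<in> ob_elements I F" "(i, Cod (F i) \<alpha>) \<in> ob_elements I F"
proof -
  show *: "i \<in> Ob I" "\<alpha> \<in> Mor (F i)"
    using assms by (auto simp: entries_def)
  interpret category "F i"
    using *(1) by (rule F_category)
  show "Dom (F i) \<alpha> \<in> Ob (F i)" "Cod (F i) \<alpha> \<in> Ob (F i)"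
    "(i, Dom (F i) \<alpha>) \<in> ob_elements I F" "(i, Cod (F i) \<alpha>) \<in> ob_elements I F"
    using * Dom_in Cod_in by (auto simp: ob_elements_def)
qed

lemma src_in: "e \<in> entries \<Longrightarrow> src e \<in> colim_Ob I F T"
  by (cases e) (auto simp: src_def intro: ob_class_in entry_ends)

lemma tgt_in: "e \<in> entries \<Longrightarrow> tgt e \<in> colim_Ob I F T"
  by (cases e) (auto simp: tgt_def intro: ob_class_in entry_ends)

text \<open>Through \<open>ob_equiv_iff\<close> and \<open>mem_colim_Ob_iff\<close>, relations and
  memberships become equations between classes; for the memberships \<open>a\<close> and
  \<open>b\<close> have to be genuine classes.\<close>

lemma strings_iff:
  assumes "a \<in> colim_Ob I F T" "b \<in> colim_Ob I F T"
  shows "s \<in> strings I F T a b \<longleftrightarrow> s \<in> chains \<and> tgt (hd s) = b \<and> src (last s) = a"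
proof (cases "s \<noteq> [] \<and> set s \<subseteq> entries")
  case True
  then have sub: "e \<in> set s \<Longrightarrow> e \<in> entries" for e
    by blast
  have join: "(case (e, e') of ((j, \<beta>), (i, \<alpha>)) \<Rightarrow>
      ((i, Cod (F i) \<alpha>), (j, Dom (F j) \<beta>)) \<in> ob_equiv I F T) \<longleftrightarrow> tgt e' = src e"
    if "e \<in> entries" "e' \<in> entries" for e e'
    using that by (cases e; cases e') (auto simp: src_def tgt_def entry_ends ob_equiv_iff)
  have "(\<forall>k. Suc k < length s \<longrightarrow> (case (s ! k, s ! Suc k) of ((j, \<beta>), (i, \<alpha>)) \<Rightarrow>
        ((i, Cod (F i) \<alpha>), (j, Dom (F j) \<beta>)) \<in> ob_equiv I F T))
      \<longleftrightarrow> (\<forall>k. Suc k < length s \<longrightarrow> tgt (s ! Suc k) = src (s ! k))"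
    by (intro iff_allI imp_cong refl join) (simp_all add: sub)
  moreover have "hd s \<in> entries" "last s \<in> entries"
    using True by (simp_all add: sub)
  then have "(case hd s of (i, \<alpha>) \<Rightarrow> (i, Cod (F i) \<alpha>) \<in> b) \<longleftrightarrow> tgt (hd s) = b"
    "(case last s of (i, \<alpha>) \<Rightarrow> (i, Dom (F i) \<alpha>) \<in> a) \<longleftrightarrow> src (last s) = a"
    using assms
    by (cases "hd s"; cases "last s"; simp add: src_def tgt_def entry_ends mem_colim_Ob_iff)+
  moreover have "\<forall>(i, \<alpha>)\<in>set s. i \<in> Ob I \<and> \<alpha> \<in> Mor (F i)"
    using True by (auto simp: entries_def)
  ultimately show ?thesis
    unfolding strings_def chains_def using True by (simp add: successively_conv_nth)
next
  case False
  then show ?thesis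
    by (auto simp: strings_def chains_def entries_def)
qed

lemma chain_ends:
  assumes "s \<in> chains"
  shows "s \<noteq> []" "src (last s) \<in> colim_Ob I F T" "tgt (hd s) \<in> colim_Ob I F T"
proof -
  show "s \<noteq> []"
    using assms by (simp add: chains_def)
  then have "last s \<in> entries" "hd s \<in> entries"
    using assms unfolding chains_def using last_in_set[of s] hd_in_set[of s] by blast+
  then show "src (last s) \<in> colim_Ob I F T" "tgt (hd s) \<in> colim_Ob I F T"
    by (simp_all add: src_in tgt_in)
qed

lemma chain_in_strings: "s \<in> chains \<Longrightarrow> s \<in> strings I F T (src (last s)) (tgt (hd s))"
  using chain_ends by (simp add: strings_iff)

lemma chains_singleton [simp]: "[e] \<in> chains \<longleftrightarrow> e \<in> entries"
  by (simp add: chains_def)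

text \<open>The head is applied last, so in \<open>s @ t\<close> the string \<open>t\<close> acts
  first and the joint lies between \<open>hd t\<close> and \<open>last s\<close>.\<close>

lemma chains_append:
  assumes "s \<noteq> []" "t \<noteq> []"
  shows "s @ t \<in> chains \<longleftrightarrow> s \<in> chains \<and> t \<in> chains \<and> tgt (hd t) = src (last s)"
  using assms by (auto simp: chains_def successively_append_iff)

lemma chains_Cons:
  "t \<noteq> [] \<Longrightarrow> e # t \<in> chains \<longleftrightarrow> e \<in> entries \<and> t \<in> chains \<and> tgt (hd t) = src e"
  using chains_append[of "[e]" t] by simp

lemma comp_entry:
  assumes "i \<in> Ob I" "\<alpha> \<in> Mor (F i)" "\<beta> \<in> Mor (F i)" "Cod (F i) \<alpha> = Dom (F i) \<beta>"
  shows "(i, Comp (F i) \<beta> \<alpha>) \<in> entries"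
    "src (i, Comp (F i) \<beta> \<alpha>) = src (i, \<alpha>)" "tgt (i, Comp (F i) \<beta> \<alpha>) = tgt (i, \<beta>)"
proof -
  interpret category "F i"
    using assms(1) by (rule F_category)
  have "Comp (F i) \<beta> \<alpha> \<in> Hom (F i) (Dom (F i) \<alpha>) (Cod (F i) \<beta>)"
    using assms by (intro Comp_in) (auto simp: Hom_iff)
  then show "(i, Comp (F i) \<beta> \<alpha>) \<in> entries"
    "src (i, Comp (F i) \<beta> \<alpha>) = src (i, \<alpha>)" "tgt (i, Comp (F i) \<beta> \<alpha>) = tgt (i, \<beta>)"
    using assms(1) by (auto simp: Hom_iff entries_def src_def tgt_def)
qed

lemma transport_entry:
  assumes "f \<in> Hom I i j" "\<alpha> \<in> Mor (F i)"
  shows "(i, \<alpha>) \<in> entries" "(j, mmap (T f) \<alpha>) \<in> entries"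
    "src (j, mmap (T f) \<alpha>) = src (i, \<alpha>)" "tgt (j, mmap (T f) \<alpha>) = tgt (i, \<alpha>)"
proof -
  interpret T: cat_functor "F i" "F j" "T f"
    using assms(1) by (rule T_functor)
  have ij: "i \<in> Ob I" "j \<in> Ob I"
    using assms(1) I.Dom_in I.Cod_in by (auto simp: Hom_iff)
  show "(i, \<alpha>) \<in> entries" "(j, mmap (T f) \<alpha>) \<in> entries"
    "src (j, mmap (T f) \<alpha>) = src (i, \<alpha>)" "tgt (j, mmap (T f) \<alpha>) = tgt (i, \<alpha>)"
    using ij assms T.mmap_Mor
    by (auto simp: entries_def src_def tgt_def T.C.Dom_in T.C.Cod_in ob_class_transport)
qed

text \<open>Both kinds of moves replace an inner block by one with the same ends, so the context is
  dealt with once here. An empty \<open>p\<close> or \<open>q\<close> exposes the block at an end of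
  the string, hence the case split.\<close>

lemma block_replace:
  assumes "u \<in> chains" "v \<in> chains" "src (last u) = src (last v)" "tgt (hd u) = tgt (hd v)"
  shows "p @ u @ q \<in> chains \<longleftrightarrow> p @ v @ q \<in> chains"
    "src (last (p @ u @ q)) = src (last (p @ v @ q))"
    "tgt (hd (p @ u @ q)) = tgt (hd (p @ v @ q))"
  using assms chain_ends(1)[of u] chain_ends(1)[of v]
  by (cases "p = []"; cases "q = []"; simp add: chains_append)+

section \<open>Elementary moves on strings\<close>

definition steps :: "(('i \<times> 'm) list \<times> ('i \<times> 'm) list) set" where
  "steps = comp_step I F \<union> transport_step I F T"

lemma step_cases:
  assumes "(s, t) \<in> steps"
  obtains (comp) p q i \<alpha> \<beta> where "s = p @ [(i, \<beta>), (i, \<alpha>)] @ q"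
      "t = p @ [(i, Comp (F i) \<beta> \<alpha>)] @ q"
      "i \<in> Ob I" "\<alpha> \<in> Mor (F i)" "\<beta> \<in> Mor (F i)" "Cod (F i) \<alpha> = Dom (F i) \<beta>"
  | (transport) p q i j f \<alpha> where "s = p @ [(i, \<alpha>)] @ q" "t = p @ [(j, mmap (T f) \<alpha>)] @ q"
      "f \<in> Hom I i j" "\<alpha> \<in> Mor (F i)"
proof -
  consider "(s, t) \<in> comp_step I F" | "(s, t) \<in> transport_step I F T"
    using assms by (auto simp: steps_def)
  then show thesis
  proof cases
    case 1
    then show thesis
      unfolding comp_step_def by (elim CollectE exE conjE Pair_inject) (rule that(1))
  next
    case 2
    then show thesis
      unfolding transport_step_def by (elim CollectE exE conjE Pair_inject) (rule that(2))
  qed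
qed

lemma comp_stepI:
  "\<lbrakk>i \<in> Ob I; \<alpha> \<in> Mor (F i); \<beta> \<in> Mor (F i); Cod (F i) \<alpha> = Dom (F i) \<beta>\<rbrakk> \<Longrightarrow>
    (p @ [(i, \<beta>), (i, \<alpha>)] @ q, p @ [(i, Comp (F i) \<beta> \<alpha>)] @ q) \<in> steps"
  unfolding steps_def comp_step_def by blast

lemma transport_stepI:
  "\<lbrakk>f \<in> Hom I i j; \<alpha> \<in> Mor (F i)\<rbrakk> \<Longrightarrow>
    (p @ [(i, \<alpha>)] @ q, p @ [(j, mmap (T f) \<alpha>)] @ q) \<in> steps"
  unfolding steps_def transport_step_def by blast

lemma steps_append: "(s, t) \<in> steps \<Longrightarrow> (p @ s @ q, p @ t @ q) \<in> steps"
proof (erule step_cases)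
  fix p' q' i \<alpha> \<beta>
  assume *: "s = p' @ [(i, \<beta>), (i, \<alpha>)] @ q'" "t = p' @ [(i, Comp (F i) \<beta> \<alpha>)] @ q'"
    "i \<in> Ob I" "\<alpha> \<in> Mor (F i)" "\<beta> \<in> Mor (F i)" "Cod (F i) \<alpha> = Dom (F i) \<beta>"
  then show ?thesis
    using comp_stepI[OF *(3-6), of "p @ p'" "q' @ q"] by simp
next
  fix p' q' i j f \<alpha>
  assume *: "s = p' @ [(i, \<alpha>)] @ q'" "t = p' @ [(j, mmap (T f) \<alpha>)] @ q'"
    "f \<in> Hom I i j" "\<alpha> \<in> Mor (F i)"
  then show ?thesis
    using transport_stepI[OF *(3-4), of "p @ p'" "q' @ q"] by simp
qed

text \<open>Instances of \<open>block_replace\<close>. As the moves keep the ends, a move that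
  starts in \<open>strings I F T a b\<close> stays there, and generating the relation for each pair
  of ends separately loses no move.\<close>

lemma step_chains:
  assumes "(s, t) \<in> steps"
  shows "s \<in> chains \<longleftrightarrow> t \<in> chains" "src (last s) = src (last t)" "tgt (hd s) = tgt (hd t)"
proof -
  have "(s \<in> chains \<longleftrightarrow> t \<in> chains) \<and> src (last s) = src (last t) \<and> tgt (hd s) = tgt (hd t)"
    using assms
  proof (cases rule: step_cases)
    case (comp p q i \<alpha> \<beta>)
    \<comment> \<open>Equality of the objects in \<open>F i\<close> implies equality of their
      classes.\<close>
    then have "[(i, \<beta>), (i, \<alpha>)] \<in> chains"
      by (simp add: chains_Cons entries_def src_def tgt_def)
    with comp show ?thesis
      using block_replace[of "[(i, \<beta>), (i, \<alpha>)]" "[(i, Comp (F i) \<beta> \<alpha>)]" p q]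
      by (simp add: comp_entry)
  next
    case (transport p q i j f \<alpha>)
    then show ?thesis
      using block_replace[of "[(i, \<alpha>)]" "[(j, mmap (T f) \<alpha>)]" p q]
      by (simp add: transport_entry)
  qed
  then show "s \<in> chains \<longleftrightarrow> t \<in> chains" "src (last s) = src (last t)" "tgt (hd s) = tgt (hd t)"
    by auto
qed

lemma equiv_string_equiv: "equiv (strings I F T a b) (string_equiv I F T a b)"
  unfolding string_equiv_def by (rule equiv_generated_equiv)

text \<open>One factor is changed at a time, through the intermediate string \<open>s' @ t\<close>;
  each half is \<open>generated_equiv_map\<close> for concatenation with a fixed string, because
  moves survive in any context.\<close>

lemma string_equiv_append:
  assumes "(s, t) \<in> string_equiv I F T a b" "(s', t') \<in> string_equiv I F T b c"
    and ob: "a \<in> colim_Ob I F T" "b \<in> colim_Ob I F T" "c \<in> colim_Ob I F T"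
  shows "(s' @ s, t' @ t) \<in> string_equiv I F T a c"
proof -
  have app: "u' @ u \<in> strings I F T a c"
    if "u \<in> strings I F T a b" "u' \<in> strings I F T b c" for u u'
    using that chain_ends(1)[of u] chain_ends(1)[of u'] by (auto simp: strings_iff ob chains_append)
  have mem: "t \<in> strings I F T a b" "s' \<in> strings I F T b c"
    "t \<in> strings I F T a b" "t' \<in> strings I F T b c"
    using assms(1,2) by (auto simp: string_equiv_def generated_equiv_def)
  have "(s' @ s, s' @ t) \<in> string_equiv I F T a c"
    using assms(1) unfolding string_equiv_def[of _ _ _ a b]
  proof (rule generated_equiv_map[OF _ equiv_string_equiv])
    fix u v assume "u \<in> strings I F T a b" "v \<in> strings I F T a b"
      "(u, v) \<in> comp_step I F \<union> transport_step I F T"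
    then show "(s' @ u, s' @ v) \<in> string_equiv I F T a c"
      using steps_append[of u v s' "[]"] app mem unfolding string_equiv_def
      by (intro generated_equivI) (auto simp: steps_def)
  qed (use app mem in auto)
  moreover have "(s' @ t, t' @ t) \<in> string_equiv I F T a c"
    using assms(2) unfolding string_equiv_def[of _ _ _ b c]
  proof (rule generated_equiv_map[OF _ equiv_string_equiv, where g = "\<lambda>u. u @ t"])
    fix u v assume "u \<in> strings I F T b c" "v \<in> strings I F T b c"
      "(u, v) \<in> comp_step I F \<union> transport_step I F T"
    then show "(u @ t, v @ t) \<in> string_equiv I F T a c"
      using steps_append[of u v "[]" t] app mem unfolding string_equiv_def
      by (intro generated_equivI) (auto simp: steps_def)
  qed (use app mem in auto)
  ultimately show ?thesis
    using equiv_string_equiv[of a c] by (meson equivE transE)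
qed

section \<open>The category of strings\<close>

text \<open>The ends are stored beside the class so that \<open>Dom\<close> and \<open>Cod\<close>
  of \<open>string_cat\<close> are projections and \<open>Comp\<close> can tell which
  \<open>string_equiv\<close> to form.\<close>

definition arrow :: "('i \<times> 'm) list \<Rightarrow> ('i \<times> 'o) set \<times> ('i \<times> 'm) list set \<times> ('i \<times> 'o) set" where
  "arrow s = (src (last s), string_equiv I F T (src (last s)) (tgt (hd s)) `` {s}, tgt (hd s))"

text \<open>The unions over representatives avoid a choice: all their members turn out to be one and
  the same class, as \<open>Comp_arrow\<close> and \<open>ident_string_cat\<close> show.\<close>

definition string_cat ::
  "(('i \<times> 'o) set, ('i \<times> 'o) set \<times> ('i \<times> 'm) list set \<times> ('i \<times> 'o) set) cat" where
  "string_cat = \<lparr>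
    Ob = colim_Ob I F T,
    Mor = arrow ` chains,
    Dom = fst,
    Cod = snd \<circ> snd,
    ident = (\<lambda>a. (a, \<Union>(i, x)\<in>a. string_equiv I F T a a `` {[(i, ident (F i) x)]}, a)),
    Comp = (\<lambda>(_, S', c) (a, S, _).
      (a, \<Union>s'\<in>S'. \<Union>s\<in>S. string_equiv I F T a c `` {s' @ s}, c))\<rparr>"

definition string_leg ::
  "'i \<Rightarrow> ('o, 'm, ('i \<times> 'o) set, ('i \<times> 'o) set \<times> ('i \<times> 'm) list set \<times> ('i \<times> 'o) set) ftr" where
  "string_leg i = \<lparr>omap = (\<lambda>x. ob_class (i, x)), mmap = (\<lambda>\<alpha>. arrow [(i, \<alpha>)])\<rparr>"

lemma string_cat_simps [simp]:
  "Ob string_cat = colim_Ob I F T"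
  "Mor string_cat = arrow ` chains"
  "Dom string_cat (arrow s) = src (last s)"
  "Cod string_cat (arrow s) = tgt (hd s)"
  by (simp_all add: string_cat_def arrow_def)

lemma string_leg_simps [simp]:
  "omap (string_leg i) x = ob_class (i, x)"
  "mmap (string_leg i) \<alpha> = arrow [(i, \<alpha>)]"
  by (simp_all add: string_leg_def)

lemma string_cat_Hom_cases:
  assumes "m \<in> Hom string_cat a b"
  obtains s where "s \<in> chains" "m = arrow s" "src (last s) = a" "tgt (hd s) = b"
  using assms by (auto simp: Hom_iff)

lemma arrow_in_Hom: "s \<in> chains \<Longrightarrow> arrow s \<in> Hom string_cat (src (last s)) (tgt (hd s))"
  by (auto simp: Hom_iff)

lemma string_cat_Hom:
  assumes "a \<in> colim_Ob I F T" "b \<in> colim_Ob I F T"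
  shows "Hom string_cat a b = (\<lambda>S. (a, S, b)) ` (strings I F T a b // string_equiv I F T a b)"
proof (intro equalityI subsetI)
  fix m assume "m \<in> Hom string_cat a b"
  then obtain s where s: "s \<in> chains" "m = arrow s" "src (last s) = a" "tgt (hd s) = b"
    by (rule string_cat_Hom_cases)
  then have "string_equiv I F T a b `` {s} \<in> strings I F T a b // string_equiv I F T a b"
    using assms by (intro quotientI) (simp add: strings_iff)
  with s show "m \<in> (\<lambda>S. (a, S, b)) ` (strings I F T a b // string_equiv I F T a b)"
    by (auto simp: arrow_def)
next
  fix m assume "m \<in> (\<lambda>S. (a, S, b)) ` (strings I F T a b // string_equiv I F T a b)"
  then obtain s where "s \<in> strings I F T a b" "m = (a, string_equiv I F T a b `` {s}, b)"
    by (auto elim!: quotientE)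
  then show "m \<in> Hom string_cat a b"
    using assms arrow_in_Hom[of s] by (auto simp: strings_iff arrow_def)
qed

text \<open>A move keeps the ends, so the two triples could differ only in the class, and the move
  itself relates the two strings.\<close>

lemma arrow_step:
  assumes "(s, t) \<in> steps" "s \<in> chains"
  shows "arrow s = arrow t"
proof -
  note st = step_chains[OF assms(1)]
  have "s \<in> strings I F T (src (last t)) (tgt (hd t))"
    "t \<in> strings I F T (src (last t)) (tgt (hd t))"
    using chain_in_strings[of s] chain_in_strings[of t] st assms(2) by auto
  then have "(s, t) \<in> string_equiv I F T (src (last t)) (tgt (hd t))"
    unfolding string_equiv_def using assms(1)
    by (intro generated_equivI) (auto simp: steps_def)
  then show ?thesis
    unfolding arrow_def st(2,3) using equiv_class_eq[OF equiv_string_equiv] by metis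
qed

text \<open>As concatenation respects the relation in both arguments, the double union collapses.
  From here on composition is append of lists, whose associativity gives that of
  \<open>string_cat\<close>.\<close>

lemma Comp_arrow:
  assumes "s \<in> chains" "t \<in> chains" "tgt (hd t) = src (last s)"
  shows "Comp string_cat (arrow s) (arrow t) = arrow (s @ t)"
proof -
  let ?a = "src (last t)" and ?b = "src (last s)" and ?c = "tgt (hd s)"
  have ob: "?a \<in> colim_Ob I F T" "?b \<in> colim_Ob I F T" "?c \<in> colim_Ob I F T"
    using assms chain_ends by auto
  have "congruent2 (string_equiv I F T ?b ?c) (string_equiv I F T ?a ?b)
      (\<lambda>s' s. string_equiv I F T ?a ?c `` {s' @ s})"
    using string_equiv_append[OF _ _ ob] equiv_class_eq[OF equiv_string_equiv]
    by (fastforce simp: congruent2_def)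
  then have "(\<Union>s'\<in>string_equiv I F T ?b ?c `` {s}. \<Union>s\<in>string_equiv I F T ?a ?b `` {t}.
      string_equiv I F T ?a ?c `` {s' @ s}) = string_equiv I F T ?a ?c `` {s @ t}"
    using chain_in_strings[OF assms(1)] chain_in_strings[OF assms(2)] assms(3)
    by (intro UN_equiv_class2[OF equiv_string_equiv equiv_string_equiv]) auto
  then show ?thesis
    using chain_ends(1)[OF assms(1)] chain_ends(1)[OF assms(2)]
    by (simp add: string_cat_def arrow_def assms(3))
qed

section \<open>Identities of the category of strings\<close>

lemma ident_entry:
  assumes "i \<in> Ob I" "x \<in> Ob (F i)"
  shows "(i, ident (F i) x) \<in> entries"
    "src (i, ident (F i) x) = ob_class (i, x)" "tgt (i, ident (F i) x) = ob_class (i, x)"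
  using category.ident_in[OF F_category[OF assms(1)] assms(2)] assms(1)
  by (auto simp: Hom_iff entries_def src_def tgt_def)

lemma arrow_ident_transport:
  assumes "f \<in> Hom I i j" "x \<in> Ob (F i)"
  shows "arrow [(i, ident (F i) x)] = arrow [(j, ident (F j) (omap (T f) x))]"
proof -
  interpret T: cat_functor "F i" "F j" "T f"
    using assms(1) by (rule T_functor)
  have "ident (F i) x \<in> Mor (F i)"
    using T.C.ident_in[OF assms(2)] by (simp add: Hom_iff)
  then show ?thesis
    using arrow_step[OF transport_stepI[OF assms(1), of "ident (F i) x" "[]" "[]"]] assms
      transport_entry[OF assms(1)]
    by (simp add: T.mmap_ident)
qed

lemma arrow_ident_cong:
  assumes "((i, x), (j, y)) \<in> ob_equiv I F T"
  shows "arrow [(i, ident (F i) x)] = arrow [(j, ident (F j) y)]"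
proof -
  let ?g = "\<lambda>(i, x). arrow [(i, ident (F i) x)]"
  have "?g (i, x) = ?g (j, y)"
    using assms unfolding ob_equiv_def
    by (rule generated_equiv_invariant[where f = ?g]) (auto simp: arrow_ident_transport)
  then show ?thesis by simp
qed

lemma ident_string_cat:
  assumes "i \<in> Ob I" "x \<in> Ob (F i)"
  shows "ident string_cat (ob_class (i, x)) = arrow [(i, ident (F i) x)]"
proof -
  let ?a = "ob_class (i, x)"
  let ?c = "\<lambda>(j, y). string_equiv I F T ?a ?a `` {[(j, ident (F j) y)]}"
  have "?c z = ?c (i, x)" if "z \<in> ?a" for z
  proof -
    obtain j y where z: "z = (j, y)" by fastforce
    have ij: "((i, x), (j, y)) \<in> ob_equiv I F T"
      using that by (simp add: z ob_class_def)
    then have "(j, y) \<in> ob_elements I F"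
      by (simp add: ob_equiv_def generated_equiv_def)
    moreover have "ob_class (j, y) = ?a"
      using equiv_class_eq[OF equiv_ob_equiv ij] by (simp add: ob_class_def)
    ultimately have "arrow [(j, ident (F j) y)] = (?a, ?c (j, y), ?a)"
      by (simp add: arrow_def ident_entry ob_elements_def)
    moreover have "arrow [(i, ident (F i) x)] = (?a, ?c (i, x), ?a)"
      using assms by (simp add: arrow_def ident_entry)
    ultimately show ?thesis
      using arrow_ident_cong[OF ij] by (simp add: z)
  qed
  then have "(\<Union>z\<in>?a. ?c z) = (\<Union>z\<in>?a. ?c (i, x))"
    by (intro SUP_cong refl)
  \<comment> \<open>A union of equal sets is that set only over a nonempty index set, and
    \<open>(i, x)\<close> witnesses this.\<close>
  also have "(i, x) \<in> ?a"
    using assms by (intro mem_ob_class) (simp add: ob_elements_def)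
  then have "(\<Union>z\<in>?a. ?c (i, x)) = ?c (i, x)"
    by auto
  finally show ?thesis
    using assms by (simp add: string_cat_def arrow_def ident_entry)
qed

text \<open>The identity class is represented on the very object \<open>Cod (F i) \<alpha>\<close>
  of the head \<open>(i, \<alpha>)\<close>. The added letter is then composable with the head inside
  \<open>F i\<close>, so one composition move and the unit law of \<open>F i\<close> absorb
  it.\<close>

lemma ident_arrow_left:
  assumes "s \<in> chains"
  shows "Comp string_cat (ident string_cat (tgt (hd s))) (arrow s) = arrow s"
proof -
  obtain i \<alpha> t where s: "s = (i, \<alpha>) # t"
    using assms chain_ends(1) by (metis neq_Nil_conv surj_pair)
  then have e: "(i, \<alpha>) \<in> entries"
    using assms by (simp add: chains_def)
  let ?x = "Cod (F i) \<alpha>"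
  let ?e = "(i, ident (F i) ?x)"
  interpret category "F i"
    using e by (intro F_category entry_ends)
  have x: "ident (F i) ?x \<in> Hom (F i) ?x ?x" "Comp (F i) (ident (F i) ?x) \<alpha> = \<alpha>"
    using e ident_in Comp_ident_left[OF Mor_in_Hom] entry_ends by auto
  have id: "ident string_cat (tgt (hd s)) = arrow [?e]"
    using e by (simp add: s tgt_def ident_string_cat entry_ends)
  have *: "?e \<in> entries" "tgt (hd s) = src ?e"
    using e by (auto simp: s tgt_def ident_entry entry_ends)
  then have "Comp string_cat (arrow [?e]) (arrow s) = arrow (?e # s)"
    using assms Comp_arrow[of "[?e]" s] by simp
  also have "?e # s \<in> chains"
    using * assms chain_ends(1)[OF assms] by (simp add: chains_Cons)
  then have "arrow (?e # s) = arrow s"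
    using arrow_step[of "?e # s" s] comp_stepI[of i \<alpha> "ident (F i) ?x" "[]" t] x e
    by (simp add: s entry_ends Hom_iff)
  finally show ?thesis
    by (simp add: id)
qed

text \<open>Mirror image: the identity is placed on the domain of the last entry and absorbed
  there.\<close>

lemma ident_arrow_right:
  assumes "s \<in> chains"
  shows "Comp string_cat (arrow s) (ident string_cat (src (last s))) = arrow s"
proof -
  obtain i \<alpha> t where s: "s = t @ [(i, \<alpha>)]"
    using assms chain_ends(1) by (metis rev_exhaust surj_pair)
  then have e: "(i, \<alpha>) \<in> entries"
    using assms by (simp add: chains_def)
  let ?x = "Dom (F i) \<alpha>"
  let ?e = "(i, ident (F i) ?x)"
  interpret category "F i"
    using e by (intro F_category entry_ends)
  have x: "ident (F i) ?x \<in> Hom (F i) ?x ?x" "Comp (F i) \<alpha> (ident (F i) ?x) = \<alpha>"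
    using e ident_in Comp_ident_right[OF Mor_in_Hom] entry_ends by auto
  have id: "ident string_cat (src (last s)) = arrow [?e]"
    using e by (simp add: s src_def ident_string_cat entry_ends)
  have *: "?e \<in> entries" "src (last s) = tgt ?e"
    using e by (auto simp: s src_def ident_entry entry_ends)
  then have "Comp string_cat (arrow s) (arrow [?e]) = arrow (s @ [?e])"
    using assms Comp_arrow[of s "[?e]"] by simp
  also have "s @ [?e] \<in> chains"
    using * assms chain_ends(1)[OF assms] by (simp add: chains_append)
  then have "arrow (s @ [?e]) = arrow s"
    using arrow_step[of "s @ [?e]" s] comp_stepI[of i "ident (F i) ?x" \<alpha> t "[]"] x e
    by (simp add: s entry_ends Hom_iff)
  finally show ?thesis
    by (simp add: id)
qed

lemma category_string_cat: "category string_cat"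
proof
  fix m a b assume "m \<in> Hom string_cat a b"
  then show "Comp string_cat (ident string_cat b) m = m"
    "Comp string_cat m (ident string_cat a) = m"
    by (auto elim!: string_cat_Hom_cases simp: ident_arrow_left ident_arrow_right)
next
  fix a assume "a \<in> Ob string_cat"
  then obtain i x where "i \<in> Ob I" "x \<in> Ob (F i)" "a = ob_class (i, x)"
    by (auto elim: colim_Ob_cases)
  then show "ident string_cat a \<in> Hom string_cat a a"
    using arrow_in_Hom[of "[(i, ident (F i) x)]"] by (simp add: ident_string_cat ident_entry)
next
  fix m n a b c assume "m \<in> Hom string_cat a b" "n \<in> Hom string_cat b c"
  then obtain s t where "s \<in> chains" "m = arrow s" "src (last s) = a" "tgt (hd s) = b"
    "t \<in> chains" "n = arrow t" "src (last t) = b" "tgt (hd t) = c"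
    by (metis string_cat_Hom_cases)
  then show "Comp string_cat n m \<in> Hom string_cat a c"
    using arrow_in_Hom[of "t @ s"] chain_ends(1)[of s] chain_ends(1)[of t]
    by (simp add: Comp_arrow chains_append)
next
  fix m n l a b c d
  assume "m \<in> Hom string_cat a b" "n \<in> Hom string_cat b c" "l \<in> Hom string_cat c d"
  then obtain s t u where "s \<in> chains" "m = arrow s" "tgt (hd s) = b"
    "t \<in> chains" "n = arrow t" "src (last t) = b" "tgt (hd t) = c"
    "u \<in> chains" "l = arrow u" "src (last u) = c"
    by (metis string_cat_Hom_cases)
  then show "Comp string_cat (Comp string_cat l n) m = Comp string_cat l (Comp string_cat n m)"
    using chain_ends(1)[of s] chain_ends(1)[of t] chain_ends(1)[of u]
    by (simp add: Comp_arrow chains_append)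
qed (auto simp: chain_ends)

text \<open>The generators of the relation are the cocone conditions: composition moves make a leg
  preserve composites, transport moves make the legs natural.\<close>

lemma cat_cocone_string_cat: "cat_cocone I F T string_cat string_leg"
proof -
  interpret Q: category string_cat by (rule category_string_cat)
  show ?thesis
  proof (intro cat_cocone.intro cat_cocone_axioms.intro cat_diagram_axioms Q.category_axioms)
    fix i assume i: "i \<in> Ob I"
    interpret category "F i" using i by (rule F_category)
    show "cat_functor (F i) string_cat (string_leg i)"
    proof unfold_locales
      fix \<alpha> \<beta> x y z assume "\<alpha> \<in> Hom (F i) x y" "\<beta> \<in> Hom (F i) y z"
      then have *: "\<alpha> \<in> Mor (F i)" "\<beta> \<in> Mor (F i)" "Cod (F i) \<alpha> = Dom (F i) \<beta>"
        by (auto simp: Hom_iff)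
      then have **: "(i, \<alpha>) \<in> entries" "(i, \<beta>) \<in> entries" "tgt (i, \<alpha>) = src (i, \<beta>)"
        using i by (auto simp: entries_def src_def tgt_def)
      then have "arrow [(i, \<beta>), (i, \<alpha>)] = arrow [(i, Comp (F i) \<beta> \<alpha>)]"
        using arrow_step[OF comp_stepI[OF i *, of "[]" "[]"]] by (simp add: chains_Cons)
      with ** show "mmap (string_leg i) (Comp (F i) \<beta> \<alpha>) =
          Comp string_cat (mmap (string_leg i) \<beta>) (mmap (string_leg i) \<alpha>)"
        by (simp add: Comp_arrow)
    next
      fix \<alpha> x y assume "\<alpha> \<in> Hom (F i) x y"
      then show "mmap (string_leg i) \<alpha> \<in>
          Hom string_cat (omap (string_leg i) x) (omap (string_leg i) y)"
        using i arrow_in_Hom[of "[(i, \<alpha>)]"]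
        by (auto simp: entries_def src_def tgt_def Hom_iff[of \<alpha>])
    qed (use i in \<open>auto simp: ident_string_cat intro!: ob_class_in simp: ob_elements_def\<close>)
  next
    fix f i j assume f: "f \<in> Hom I i j"
    have "arrow [(j, mmap (T f) \<alpha>)] = arrow [(i, \<alpha>)]" if "\<alpha> \<in> Mor (F i)" for \<alpha>
      using arrow_step[OF transport_stepI[OF f that, of "[]" "[]"]] transport_entry[OF f that]
      by simp
    then show "ftr_eq (F i) (ftr_comp (string_leg j) (T f)) (string_leg i)"
      using f by (simp add: ftr_eq_def ob_class_transport)
  qed
qed

end

section \<open>The universal property of the category of strings\<close>

context cat_cocone
begin

lemma leg_Mor:
  assumes "i \<in> Ob I" "\<alpha> \<in> Mor (F i)"
  shows "mmap (\<iota> i) \<alpha> \<in> Hom C (omap (\<iota> i) (Dom (F i) \<alpha>)) (omap (\<iota> i) (Cod (F i) \<alpha>))"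
proof -
  interpret L: cat_functor "F i" C "\<iota> i"
    using assms(1) by (rule leg_functor)
  show ?thesis
    using assms(2) by (intro L.mmap_in Mor_in_Hom)
qed

text \<open>Naturality of the legs on objects makes the image invariant under the relation that
  generates the classes.\<close>

lemma class_ob_class:
  assumes "i \<in> Ob I" "x \<in> Ob (F i)"
  shows "class_ob \<iota> (ob_class (i, x)) = omap (\<iota> i) x"
proof -
  let ?g = "\<lambda>(i, x). omap (\<iota> i) x"
  have "?g z = ?g (i, x)" if "z \<in> ob_class (i, x)" for z
  proof -
    have "((i, x), z) \<in> ob_equiv I F T"
      using that by (simp add: ob_class_def)
    then have "?g (i, x) = ?g z"
      unfolding ob_equiv_def
      by (rule generated_equiv_invariant[where f = ?g]) (use leg_natural in \<open>force simp: ftr_eq_def\<close>)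
    then show ?thesis ..
  qed
  then show ?thesis
    unfolding class_ob_def using assms
    by (subst the_elem_image_constant[of "(i, x)"]) (auto simp: ob_elements_def intro!: mem_ob_class)
qed

text \<open>Letters from different categories become composable in \<open>C\<close>, because
  \<open>class_ob\<close> sees only the classes of their ends.\<close>

lemma leg_entry:
  assumes "(i, \<alpha>) \<in> entries"
  shows "mmap (\<iota> i) \<alpha> \<in> Hom C (class_ob \<iota> (src (i, \<alpha>))) (class_ob \<iota> (tgt (i, \<alpha>)))"
  using leg_Mor[of i \<alpha>] entry_ends[OF assms] by (simp add: src_def tgt_def class_ob_class)

section \<open>Evaluation of strings along a cocone\<close>

lemma string_value_Cons:
  "t \<noteq> [] \<Longrightarrow> string_value C \<iota> ((i, \<alpha>) # t) = Comp C (mmap (\<iota> i) \<alpha>) (string_value C \<iota> t)"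
  by (cases t) auto

lemma string_value_in:
  "s \<in> chains \<Longrightarrow> string_value C \<iota> s \<in>
    Hom C (class_ob \<iota> (src (last s))) (class_ob \<iota> (tgt (hd s)))"
proof (induction s)
  case (Cons e t)
  obtain i \<alpha> where e: "e = (i, \<alpha>)" by fastforce
  show ?case
  proof (cases "t = []")
    case True
    with Cons.prems show ?thesis by (simp add: e leg_entry)
  next
    case False
    with Cons show ?thesis
      using leg_entry[of i \<alpha>] C.Comp_in by (simp add: e chains_Cons string_value_Cons)
  qed
qed (simp add: chains_def)

text \<open>Induction on \<open>s\<close>, moving the value of the head outward by associativity in
  \<open>C\<close>. The value of the empty list is junk, so the one-letter \<open>s\<close> is the
  true base case.\<close>

lemma string_value_append:
  assumes "s \<in> chains" "t \<in> chains" "tgt (hd t) = src (last s)"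
  shows "string_value C \<iota> (s @ t) = Comp C (string_value C \<iota> s) (string_value C \<iota> t)"
  using assms
proof (induction s)
  case (Cons e s)
  obtain i \<alpha> where e: "e = (i, \<alpha>)" by fastforce
  have t: "t \<noteq> []" "string_value C \<iota> t \<in>
      Hom C (class_ob \<iota> (src (last t))) (class_ob \<iota> (tgt (hd t)))"
    using chain_ends(1) string_value_in Cons.prems(2) by blast+
  show ?case
  proof (cases "s = []")
    case True
    with t show ?thesis by (simp add: e string_value_Cons)
  next
    case False
    then have *: "(i, \<alpha>) \<in> entries" "s \<in> chains" "tgt (hd s) = src (i, \<alpha>)"
      "tgt (hd t) = src (last s)"
      using Cons.prems by (simp_all add: e chains_Cons)
    have "string_value C \<iota> (s @ t) = Comp C (string_value C \<iota> s) (string_value C \<iota> t)"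
      using * Cons.IH Cons.prems(2) by simp
    moreover have "Comp C (Comp C (mmap (\<iota> i) \<alpha>) (string_value C \<iota> s)) (string_value C \<iota> t) =
        Comp C (mmap (\<iota> i) \<alpha>) (Comp C (string_value C \<iota> s) (string_value C \<iota> t))"
      using C.Comp_assoc[OF _ _ leg_entry[OF *(1)]] t(2) string_value_in[OF *(2)] *(3,4) by simp
    ultimately show ?thesis
      using False t by (simp add: e string_value_Cons)
  qed
qed (simp add: chains_def)

text \<open>The composite is nested to the right, so a prefix meets the rest only through its value.
  This strips the context to the left of a move.\<close>

lemma string_value_cong:
  assumes "u \<noteq> []" "v \<noteq> []" "string_value C \<iota> u = string_value C \<iota> v"
  shows "string_value C \<iota> (p @ u) = string_value C \<iota> (p @ v)"
  by (induction p) (use assms in \<open>auto simp: string_value_Cons\<close>)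

text \<open>A composition move is invisible because the leg preserves composites and
  \<open>C\<close> is associative, a transport move because the legs are natural.\<close>

lemma string_value_step:
  assumes "(s, t) \<in> steps" "s \<in> chains"
  shows "string_value C \<iota> s = string_value C \<iota> t"
  using assms(1)
proof (cases rule: step_cases)
  case (comp p q i \<alpha> \<beta>)
  interpret L: cat_functor "F i" C "\<iota> i"
    using comp by (intro leg_functor)
  let ?c = "Comp (F i) \<beta> \<alpha>"
  have c: "mmap (\<iota> i) ?c = Comp C (mmap (\<iota> i) \<beta>) (mmap (\<iota> i) \<alpha>)"
    using comp L.mmap_Comp[OF Mor_in_Hom] by (simp add: Hom_iff)
  have "string_value C \<iota> ((i, \<beta>) # (i, \<alpha>) # q) = string_value C \<iota> ((i, ?c) # q)"
  proof (cases "q = []")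
    case True
    then show ?thesis by (simp add: c)
  next
    case False
    \<comment> \<open>Associativity in \<open>C\<close> is available only for composable morphisms;
      composability comes from the part of the string from the move onwards being a chain.\<close>
    have "(i, \<beta>) # (i, \<alpha>) # q \<in> chains"
      using assms(2) comp(1) by (cases "p = []") (auto simp: chains_append)
    then have *: "(i, \<alpha>) \<in> entries" "(i, \<beta>) \<in> entries" "q \<in> chains"
      "tgt (hd q) = src (i, \<alpha>)" "tgt (i, \<alpha>) = src (i, \<beta>)"
      using False by (auto simp: chains_Cons)
    then show ?thesis
      using False C.Comp_assoc[OF _ _ leg_entry[OF *(2)]] string_value_in[OF *(3)]
        leg_entry[OF *(1)]
      by (simp add: string_value_Cons c)
  qed
  then show ?thesis
    using string_value_cong comp(1,2) by simp
next
  case (transport p q i j f \<alpha>)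
  then have "mmap (\<iota> j) (mmap (T f) \<alpha>) = mmap (\<iota> i) \<alpha>"
    using leg_natural by (simp add: ftr_eq_def)
  then have "string_value C \<iota> ((i, \<alpha>) # q) = string_value C \<iota> ((j, mmap (T f) \<alpha>) # q)"
    by (cases "q = []") (auto simp: string_value_Cons)
  then show ?thesis
    using string_value_cong transport(1,2) by simp
qed

lemma string_value_respects:
  assumes "a \<in> colim_Ob I F T" "b \<in> colim_Ob I F T"
  shows "string_value C \<iota> respects string_equiv I F T a b"
proof (rule congruentI)
  fix s t assume "(s, t) \<in> string_equiv I F T a b"
  then show "string_value C \<iota> s = string_value C \<iota> t"
    unfolding string_equiv_def
    by (rule generated_equiv_invariant[where f = "string_value C \<iota>"])
      (use assms in \<open>auto simp: strings_iff steps_def intro!: string_value_step\<close>)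
qed

lemma class_value_class:
  assumes "a \<in> colim_Ob I F T" "b \<in> colim_Ob I F T" "s \<in> strings I F T a b"
  shows "class_value C \<iota> (string_equiv I F T a b `` {s}) = string_value C \<iota> s"
  unfolding class_value_def
  using equiv_class_self[OF equiv_string_equiv assms(3)] string_value_respects[OF assms(1,2)]
  by (intro the_elem_image_constant) (auto simp: congruent_def)

text \<open>The mediating functor, available for every cocone. It forgets the two stored ends, so on
  hom-sets it is \<open>class_value\<close>, which is how the bijection of the theorem is obtained
  from it.\<close>

definition string_ftr ::
  "(('i \<times> 'o) set, ('i \<times> 'o) set \<times> ('i \<times> 'm) list set \<times> ('i \<times> 'o) set, 'p, 'q) ftr" where
  "string_ftr = \<lparr>omap = class_ob \<iota>, mmap = (\<lambda>(a, S, b). class_value C \<iota> S)\<rparr>"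

lemma string_ftr_simps [simp]:
  "omap string_ftr a = class_ob \<iota> a"
  "mmap string_ftr (a, S, b) = class_value C \<iota> S"
  by (simp_all add: string_ftr_def)

lemma mmap_string_ftr_arrow [simp]:
  "s \<in> chains \<Longrightarrow> mmap string_ftr (arrow s) = string_value C \<iota> s"
  using chain_ends chain_in_strings by (simp add: arrow_def class_value_class)

lemma cat_functor_string_ftr: "cat_functor string_cat C string_ftr"
proof -
  interpret Q: category string_cat by (rule category_string_cat)
  show ?thesis
  proof unfold_locales
    fix a assume "a \<in> Ob string_cat"
    then obtain i x where a: "i \<in> Ob I" "x \<in> Ob (F i)" "a = ob_class (i, x)"
      by (auto elim: colim_Ob_cases)
    interpret L: cat_functor "F i" C "\<iota> i"
      using a(1) by (rule leg_functor)
    show "omap string_ftr a \<in> Ob C"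
      using a L.omap_in by (simp add: class_ob_class)
    show "mmap string_ftr (ident string_cat a) = ident C (omap string_ftr a)"
      using a L.mmap_ident by (simp add: class_ob_class ident_string_cat ident_entry)
  next
    fix m a b assume "m \<in> Hom string_cat a b"
    then show "mmap string_ftr m \<in> Hom C (omap string_ftr a) (omap string_ftr b)"
      by (auto elim!: string_cat_Hom_cases simp: string_value_in)
  next
    fix m n a b c assume "m \<in> Hom string_cat a b" "n \<in> Hom string_cat b c"
    then obtain s t where "s \<in> chains" "m = arrow s" "tgt (hd s) = b"
      "t \<in> chains" "n = arrow t" "src (last t) = b"
      by (metis string_cat_Hom_cases)
    then show "mmap string_ftr (Comp string_cat n m) =
        Comp C (mmap string_ftr n) (mmap string_ftr m)"
      using chain_ends(1)[of s] chain_ends(1)[of t]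
      by (simp add: Comp_arrow chains_append string_value_append)
  qed
qed

lemma string_ftr_leg:
  assumes "i \<in> Ob I"
  shows "ftr_eq (F i) (ftr_comp string_ftr (string_leg i)) (\<iota> i)"
  using assms by (auto simp: ftr_eq_def class_ob_class entries_def)

text \<open>Every arrow is a composite of one-letter arrows, and these lie in the images of the
  legs; likewise every class of objects has a representative \<open>(i, x)\<close>. So a functor is
  determined by its composites with the legs.\<close>

lemma string_ftr_unique:
  assumes "cat_functor string_cat C K"
    and leg: "\<And>i. i \<in> Ob I \<Longrightarrow> ftr_eq (F i) (ftr_comp K (string_leg i)) (\<iota> i)"
  shows "ftr_eq string_cat K string_ftr"
proof -
  interpret K: cat_functor string_cat C K by fact
  have "mmap K (arrow s) = string_value C \<iota> s" if "s \<in> chains" for s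
    using that
  proof (induction s)
    case (Cons e t)
    obtain i \<alpha> where e: "e = (i, \<alpha>)" by fastforce
    with Cons.prems have i: "i \<in> Ob I" "\<alpha> \<in> Mor (F i)"
      by (auto simp: chains_def entries_def)
    then have single: "mmap K (arrow [(i, \<alpha>)]) = mmap (\<iota> i) \<alpha>"
      using leg by (auto simp: ftr_eq_def)
    show ?case
    proof (cases "t = []")
      case True
      with single show ?thesis by (simp add: e)
    next
      case False
      with Cons.prems have *: "[(i, \<alpha>)] \<in> chains" "t \<in> chains" "tgt (hd t) = src (i, \<alpha>)"
        by (simp_all add: e chains_Cons)
      then have "arrow (e # t) = Comp string_cat (arrow [(i, \<alpha>)]) (arrow t)"
        by (simp add: e Comp_arrow)
      then have "mmap K (arrow (e # t)) = Comp C (mmap K (arrow [(i, \<alpha>)])) (mmap K (arrow t))"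
        using K.mmap_Comp[OF arrow_in_Hom[OF *(2)], of "arrow [(i, \<alpha>)]"] arrow_in_Hom[OF *(1)] *(3)
        by simp
      with False * show ?thesis
        by (simp add: single Cons.IH string_value_Cons e)
    qed
  qed (simp add: chains_def)
  moreover have "omap K a = class_ob \<iota> a" if "a \<in> colim_Ob I F T" for a
    using that leg by (auto elim!: colim_Ob_cases simp: class_ob_class ftr_eq_def)
  ultimately show ?thesis
    by (auto simp: ftr_eq_def)
qed

end

section \<open>Relabelling a category along injections\<close>

text \<open>Transport of structure to other types, decoding by \<open>inv_into\<close>. Off the
  images the values are junk.\<close>

definition relabel :: "('o \<Rightarrow> 'p) \<Rightarrow> ('m \<Rightarrow> 'q) \<Rightarrow> ('o, 'm) cat \<Rightarrow> ('p, 'q) cat" where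
  "relabel eo em C = \<lparr>
    Ob = eo ` Ob C,
    Mor = em ` Mor C,
    Dom = (\<lambda>f. eo (Dom C (inv_into (Mor C) em f))),
    Cod = (\<lambda>f. eo (Cod C (inv_into (Mor C) em f))),
    ident = (\<lambda>x. em (ident C (inv_into (Ob C) eo x))),
    Comp = (\<lambda>g f. em (Comp C (inv_into (Mor C) em g) (inv_into (Mor C) em f)))\<rparr>"

definition relabelling :: "('o \<Rightarrow> 'p) \<Rightarrow> ('m \<Rightarrow> 'q) \<Rightarrow> ('o, 'm, 'p, 'q) ftr" where
  "relabelling eo em = \<lparr>omap = eo, mmap = em\<rparr>"

definition unlabelling ::
  "('o \<Rightarrow> 'p) \<Rightarrow> ('m \<Rightarrow> 'q) \<Rightarrow> ('o, 'm) cat \<Rightarrow> ('p, 'q, 'o, 'm) ftr" where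
  "unlabelling eo em C = \<lparr>omap = inv_into (Ob C) eo, mmap = inv_into (Mor C) em\<rparr>"

context category
begin

context
  fixes eo :: "'o \<Rightarrow> 'p" and em :: "'m \<Rightarrow> 'q"
  assumes inj_eo: "inj_on eo (Ob C)" and inj_em: "inj_on em (Mor C)"
begin

lemma relabel_simps:
  "Ob (relabel eo em C) = eo ` Ob C"
  "Mor (relabel eo em C) = em ` Mor C"
  "f \<in> Mor C \<Longrightarrow> Dom (relabel eo em C) (em f) = eo (Dom C f)"
  "f \<in> Mor C \<Longrightarrow> Cod (relabel eo em C) (em f) = eo (Cod C f)"
  "x \<in> Ob C \<Longrightarrow> ident (relabel eo em C) (eo x) = em (ident C x)"
  "\<lbrakk>f \<in> Mor C; g \<in> Mor C\<rbrakk> \<Longrightarrow> Comp (relabel eo em C) (em g) (em f) = em (Comp C g f)"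
  using inj_eo inj_em by (simp_all add: relabel_def)

lemma Hom_relabel_cases:
  assumes "m \<in> Hom (relabel eo em C) a b"
  obtains f where "f \<in> Mor C" "m = em f" "a = eo (Dom C f)" "b = eo (Cod C f)"
  using assms by (auto simp: Hom_iff relabel_simps)

lemma em_in_Hom: "f \<in> Hom C x y \<Longrightarrow> em f \<in> Hom (relabel eo em C) (eo x) (eo y)"
  by (auto simp: Hom_iff relabel_simps)

text \<open>Injectivity on objects turns equal labels back into composability in
  \<open>C\<close>.\<close>

lemma eo_eq_iff: "x \<in> Ob C \<Longrightarrow> y \<in> Ob C \<Longrightarrow> eo x = eo y \<longleftrightarrow> x = y"
  using inj_eo by (auto dest: inj_onD)

lemma Comp_Mor:
  assumes "f \<in> Mor C" "g \<in> Mor C" "Cod C f = Dom C g"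
  shows "Comp C g f \<in> Mor C" "Dom C (Comp C g f) = Dom C f" "Cod C (Comp C g f) = Cod C g"
  using Comp_in[of f "Dom C f" "Cod C f" g "Cod C g"] assms by (auto simp: Hom_iff)

lemma ident_Mor:
  assumes "x \<in> Ob C"
  shows "ident C x \<in> Mor C" "Dom C (ident C x) = x" "Cod C (ident C x) = x"
  using ident_in[OF assms] by (auto simp: Hom_iff)

lemma category_relabel: "category (relabel eo em C)"
proof
  fix m a b assume "m \<in> Hom (relabel eo em C) a b"
  then show "Comp (relabel eo em C) (ident (relabel eo em C) b) m = m"
    "Comp (relabel eo em C) m (ident (relabel eo em C) a) = m"
    by (auto elim!: Hom_relabel_cases simp: relabel_simps Dom_in Cod_in ident_Mor
        Comp_ident_left[OF Mor_in_Hom] Comp_ident_right[OF Mor_in_Hom])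
next
  fix m n a b c assume "m \<in> Hom (relabel eo em C) a b" "n \<in> Hom (relabel eo em C) b c"
  then obtain f g where "f \<in> Mor C" "m = em f" "a = eo (Dom C f)" "b = eo (Cod C f)"
    "g \<in> Mor C" "n = em g" "b = eo (Dom C g)" "c = eo (Cod C g)"
    by (metis Hom_relabel_cases)
  then show "Comp (relabel eo em C) n m \<in> Hom (relabel eo em C) a c"
    by (auto simp: Hom_iff relabel_simps Comp_Mor eo_eq_iff Dom_in Cod_in)
next
  fix m n l a b c d assume "m \<in> Hom (relabel eo em C) a b" "n \<in> Hom (relabel eo em C) b c"
    "l \<in> Hom (relabel eo em C) c d"
  then obtain f g h where "f \<in> Mor C" "m = em f" "b = eo (Cod C f)"
    "g \<in> Mor C" "n = em g" "b = eo (Dom C g)" "c = eo (Cod C g)"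
    "h \<in> Mor C" "l = em h" "c = eo (Dom C h)"
    by (metis Hom_relabel_cases)
  moreover from this have "Comp C (Comp C h g) f = Comp C h (Comp C g f)"
    by (intro Comp_assoc[of f "Dom C f" "Dom C g" g "Dom C h" h "Cod C h"])
      (auto simp: Hom_iff eo_eq_iff Dom_in Cod_in)
  ultimately show "Comp (relabel eo em C) (Comp (relabel eo em C) l n) m =
      Comp (relabel eo em C) l (Comp (relabel eo em C) n m)"
    by (auto simp: relabel_simps Comp_Mor eo_eq_iff Dom_in Cod_in)
qed (auto simp: relabel_simps Dom_in Cod_in intro!: em_in_Hom ident_in)

lemma cat_functor_relabelling: "cat_functor C (relabel eo em C) (relabelling eo em)"
proof -
  interpret R: category "relabel eo em C" by (rule category_relabel)
  show ?thesis
    by unfold_locales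
      (auto simp: relabelling_def relabel_simps Hom_iff)
qed

lemma cat_functor_unlabelling: "cat_functor (relabel eo em C) C (unlabelling eo em C)"
proof -
  interpret R: category "relabel eo em C" by (rule category_relabel)
  show ?thesis
  proof unfold_locales
    fix m n a b c assume "m \<in> Hom (relabel eo em C) a b" "n \<in> Hom (relabel eo em C) b c"
    then obtain f g where "f \<in> Mor C" "m = em f" "b = eo (Cod C f)"
      "g \<in> Mor C" "n = em g" "b = eo (Dom C g)"
      by (metis Hom_relabel_cases)
    then show "mmap (unlabelling eo em C) (Comp (relabel eo em C) n m) =
        Comp C (mmap (unlabelling eo em C) n) (mmap (unlabelling eo em C) m)"
      using inj_em
      by (simp add: unlabelling_def relabel_simps Comp_Mor eo_eq_iff Dom_in Cod_in)
  next
    fix m a b assume "m \<in> Hom (relabel eo em C) a b"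
    then obtain f where "f \<in> Mor C" "m = em f" "a = eo (Dom C f)" "b = eo (Cod C f)"
      by (rule Hom_relabel_cases)
    then show "mmap (unlabelling eo em C) m \<in>
        Hom C (omap (unlabelling eo em C) a) (omap (unlabelling eo em C) b)"
      using inj_em inj_eo by (simp add: unlabelling_def Hom_iff Dom_in Cod_in)
  qed (use inj_em inj_eo in \<open>auto simp: relabel_simps unlabelling_def ident_Mor\<close>)
qed

lemma unlabelling_relabelling: "ftr_eq C (ftr_comp (unlabelling eo em C) (relabelling eo em)) ftr_id"
  using inj_em inj_eo by (simp add: ftr_eq_def ftr_id_def unlabelling_def relabelling_def)

lemma relabelling_unlabelling:
  "ftr_eq (relabel eo em C) (ftr_comp (relabelling eo em) (unlabelling eo em C)) ftr_id"
  by (auto simp: ftr_eq_def ftr_id_def unlabelling_def relabelling_def relabel_simps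
      f_inv_into_f)

end

end

section \<open>Coding finite lists in an infinite set\<close>

lemma exists_inj_lists:
  assumes "infinite (UNIV :: 'u set)"
  shows "\<exists>l :: ('u \<times> 'u) list \<Rightarrow> 'u. inj l"
proof -
  obtain p :: "'u \<times> 'u \<Rightarrow> 'u" where p: "inj p"
    using ordIso_imp_ordLeq[OF card_of_Times_same_infinite[OF assms]]
    unfolding card_of_ordLeq[symmetric] by auto
  obtain n :: "nat \<Rightarrow> 'u" where n: "inj n"
    using infinite_countable_subset[OF assms] by auto
  \<comment> \<open>The inner \<open>p\<close> codes an entry, which is a pair, and the outer
    \<open>p\<close> codes a cons cell; the start value \<open>n 0\<close> is arbitrary.\<close>
  define c where "c xs = foldr (\<lambda>x y. p (p x, y)) xs (n 0)" for xs
  have "xs = ys" if "length xs = length ys" "c xs = c ys" for xs ys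
    using that by (induction rule: list_induct2) (auto simp: c_def dest!: injD[OF p])
  \<comment> \<open>Injectivity of \<open>c\<close> is known only among lists of equal length, as
    \<open>n 0\<close> may itself be the code of a pair; the length is therefore recorded as
    well.\<close>
  then have "inj (\<lambda>xs. p (n (length xs), c xs))"
    by (auto intro!: injI dest!: injD[OF p] injD[OF n])
  then show ?thesis by blast
qed

section \<open>Colimits\<close>

lemma inverse_functors_bij:
  assumes "cat_functor A B H" "cat_functor B A G"
    and GH: "ftr_eq A (ftr_comp G H) ftr_id" and HG: "ftr_eq B (ftr_comp H G) ftr_id"
  shows "bij_betw (omap H) (Ob A) (Ob B)"
    and "\<lbrakk>x \<in> Ob A; y \<in> Ob A\<rbrakk> \<Longrightarrow> bij_betw (mmap H) (Hom A x y) (Hom B (omap H x) (omap H y))"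
proof -
  interpret H: cat_functor A B H by fact
  interpret G: cat_functor B A G by fact
  have ob: "omap G (omap H x) = x" if "x \<in> Ob A" for x
    using GH that by (simp add: ftr_eq_def ftr_id_def)
  show "bij_betw (omap H) (Ob A) (Ob B)"
    using HG by (intro bij_betw_byWitness[where f' = "omap G"])
      (auto simp: ob ftr_eq_def ftr_id_def H.omap_in G.omap_in)
  assume "x \<in> Ob A" "y \<in> Ob A"
  then show "bij_betw (mmap H) (Hom A x y) (Hom B (omap H x) (omap H y))"
    using GH HG H.mmap_in[of _ x y] G.mmap_in[of _ "omap H x" "omap H y"]
    by (intro bij_betw_byWitness[where f' = "mmap G"])
      (auto simp: ob ftr_eq_def ftr_id_def Hom_iff)
qed

lemma ftr_eq_refl: "ftr_eq C H H"
  and ftr_eq_sym: "ftr_eq C H K \<Longrightarrow> ftr_eq C K H"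
  and ftr_eq_trans: "\<lbrakk>ftr_eq C H K; ftr_eq C K L\<rbrakk> \<Longrightarrow> ftr_eq C H L"
  by (auto simp: ftr_eq_def)

lemma ftr_comp_assoc: "ftr_comp (ftr_comp L K) H = ftr_comp L (ftr_comp K H)"
  by (simp add: ftr_comp_def comp_assoc)

lemma ftr_comp_id [simp]: "ftr_comp ftr_id H = H" "ftr_comp H ftr_id = H"
  by (simp_all add: ftr_comp_def ftr_id_def comp_def)

lemma ftr_eq_comp_left: "ftr_eq C H K \<Longrightarrow> ftr_eq C (ftr_comp L H) (ftr_comp L K)"
  by (simp add: ftr_eq_def)

text \<open>\<open>ftr_eq\<close> compares values on the objects and morphisms of \<open>C\<close>
  only, so \<open>H\<close> has to land there.\<close>

lemma ftr_eq_comp_right: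
  assumes "cat_functor A C H" "ftr_eq C L K"
  shows "ftr_eq A (ftr_comp L H) (ftr_comp K H)"
proof -
  interpret cat_functor A C H by fact
  show ?thesis
    using assms(2) omap_in mmap_Mor(1) by (simp add: ftr_eq_def)
qed

text \<open>The legs are jointly epic: composing \<open>L\<close> with them gives a cocone, and both
  functors are its mediating functor.\<close>

lemma (in cat_diagram) string_cat_ftr_eq:
  assumes "cat_functor string_cat D K" "cat_functor string_cat D L"
    and "\<And>i. i \<in> Ob I \<Longrightarrow> ftr_eq (F i) (ftr_comp K (string_leg i)) (ftr_comp L (string_leg i))"
  shows "ftr_eq string_cat K L"
proof -
  interpret cat_cocone I F T D "\<lambda>i. ftr_comp L (string_leg i)"
    using cat_cocone_comp[OF cat_cocone_string_cat assms(2)] .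
  show ?thesis
    using string_ftr_unique[OF assms(1,3)] string_ftr_unique[OF assms(2) ftr_eq_refl]
    by (auto intro: ftr_eq_trans[OF _ ftr_eq_sym])
qed

lemma colimit_cocone: "is_colimit I F T C \<iota> \<Longrightarrow> cat_cocone I F T C \<iota>"
  by (simp add: is_colimit_def)

lemma colimit_universal:
  fixes C D :: "('u, 'u) cat"
  assumes "is_colimit I F T C \<iota>" "cat_cocone I F T D \<kappa>"
  shows "\<exists>H. cat_functor C D H \<and>
    (\<forall>i\<in>Ob I. ftr_eq (F i) (ftr_comp H (\<iota> i)) (\<kappa> i)) \<and>
    (\<forall>K. cat_functor C D K \<and> (\<forall>i\<in>Ob I. ftr_eq (F i) (ftr_comp K (\<iota> i)) (\<kappa> i))
      \<longrightarrow> ftr_eq C K H)"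
  using assms by (simp add: is_colimit_def)

lemma colimit_factor:
  fixes C D :: "('u, 'u) cat"
  assumes "is_colimit I F T C \<iota>" "cat_cocone I F T D \<kappa>"
  obtains H where "cat_functor C D H"
    "\<And>i. i \<in> Ob I \<Longrightarrow> ftr_eq (F i) (ftr_comp H (\<iota> i)) (\<kappa> i)"
  using colimit_universal[OF assms] by blast

text \<open>The same argument for a colimit, with the uniqueness clause of \<open>is_colimit\<close>
  in place of \<open>string_ftr_unique\<close>.\<close>

lemma colimit_ftr_eq:
  fixes C D :: "('u, 'u) cat"
  assumes C: "is_colimit I F T C \<iota>" and KL: "cat_functor C D K" "cat_functor C D L"
    and eq: "\<And>i. i \<in> Ob I \<Longrightarrow> ftr_eq (F i) (ftr_comp K (\<iota> i)) (ftr_comp L (\<iota> i))"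
  shows "ftr_eq C K L"
proof -
  have "cat_cocone I F T D (\<lambda>i. ftr_comp L (\<iota> i))"
    using cat_cocone_comp[OF colimit_cocone[OF C] KL(2)] .
  then obtain H where H: "\<And>K. \<lbrakk>cat_functor C D K;
      \<forall>i\<in>Ob I. ftr_eq (F i) (ftr_comp K (\<iota> i)) (ftr_comp L (\<iota> i))\<rbrakk> \<Longrightarrow> ftr_eq C K H"
    using colimit_universal[OF C] by blast
  have "ftr_eq C K H" "ftr_eq C L H"
    using KL eq by (auto intro!: H simp: ftr_eq_refl)
  then show ?thesis
    by (rule ftr_eq_trans[OF _ ftr_eq_sym])
qed

section \<open>Copies of the category of strings on other types\<close>

context cat_diagram
begin

context
  fixes eo :: "('i \<times> 'o) set \<Rightarrow> 'p"
    and em :: "('i \<times> 'o) set \<times> ('i \<times> 'm) list set \<times> ('i \<times> 'o) set \<Rightarrow> 'q"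
  assumes inj: "inj_on eo (Ob string_cat)" "inj_on em (Mor string_cat)"
begin

abbreviation "labelled \<equiv> relabel eo em string_cat"
abbreviation "label \<equiv> relabelling eo em"
abbreviation "unlabel \<equiv> unlabelling eo em string_cat"

lemmas label_functor = category.cat_functor_relabelling[OF category_string_cat inj]
lemmas unlabel_functor = category.cat_functor_unlabelling[OF category_string_cat inj]

lemma unlabel_label_leg:
  assumes "i \<in> Ob I"
  shows "ftr_eq (F i) (ftr_comp unlabel (ftr_comp label (string_leg i))) (string_leg i)"
  using ftr_eq_comp_right[OF cat_cocone.leg_functor[OF cat_cocone_string_cat assms]
      category.unlabelling_relabelling[OF category_string_cat inj]]
  by (simp add: ftr_comp_assoc)

lemma cat_cocone_labelled: "cat_cocone I F T labelled (\<lambda>i. ftr_comp label (string_leg i))"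
  using cat_cocone_comp[OF cat_cocone_string_cat label_functor] .

text \<open>The universal clause of \<open>is_colimit\<close> for a copy of
  \<open>string_cat\<close>, with \<open>D\<close> over arbitrary types. Its mediating functors are
  those of \<open>string_cat\<close> preceded by \<open>unlabel\<close>.\<close>

lemma labelled_factor:
  assumes "cat_cocone I F T D \<kappa>"
  shows "\<exists>H. cat_functor labelled D H \<and>
    (\<forall>i\<in>Ob I. ftr_eq (F i) (ftr_comp H (ftr_comp label (string_leg i))) (\<kappa> i)) \<and>
    (\<forall>K. cat_functor labelled D K \<and>
      (\<forall>i\<in>Ob I. ftr_eq (F i) (ftr_comp K (ftr_comp label (string_leg i))) (\<kappa> i))
      \<longrightarrow> ftr_eq labelled K H)"
proof -
  interpret K: cat_cocone I F T D \<kappa> by fact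
  let ?H = "ftr_comp K.string_ftr unlabel"
  have "cat_functor labelled D ?H"
    using cat_functor_comp[OF unlabel_functor K.cat_functor_string_ftr] .
  moreover have "ftr_eq (F i) (ftr_comp ?H (ftr_comp label (string_leg i))) (\<kappa> i)"
    if "i \<in> Ob I" for i
    using ftr_eq_trans[OF ftr_eq_comp_left[OF unlabel_label_leg[OF that]] K.string_ftr_leg[OF that]]
    by (simp add: ftr_comp_assoc)
  moreover have "ftr_eq labelled L ?H"
    if L: "cat_functor labelled D L"
      "\<forall>i\<in>Ob I. ftr_eq (F i) (ftr_comp L (ftr_comp label (string_leg i))) (\<kappa> i)" for L
  proof -
    \<comment> \<open>Precomposition with \<open>label\<close> brings \<open>L\<close> under the
      uniqueness for \<open>string_cat\<close>; precomposition with \<open>unlabel\<close> then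
      undoes it.\<close>
    have "ftr_eq string_cat (ftr_comp L label) K.string_ftr"
      using L by (intro K.string_ftr_unique cat_functor_comp[OF label_functor])
        (auto simp: ftr_comp_assoc)
    from ftr_eq_comp_right[OF unlabel_functor this]
    have "ftr_eq labelled (ftr_comp L (ftr_comp label unlabel)) ?H"
      by (simp add: ftr_comp_assoc)
    moreover have "ftr_eq labelled (ftr_comp L (ftr_comp label unlabel)) L"
      using ftr_eq_comp_left[OF category.relabelling_unlabelling[OF category_string_cat inj], of L]
      by simp
    ultimately show ?thesis
      by (rule ftr_eq_trans[OF ftr_eq_sym, rotated])
  qed
  ultimately show ?thesis
    by blast
qed

end

end

text \<open>A choice of representatives embeds the objects into pairs and the morphisms into lists
  of pairs, and \<open>l\<close> codes both, a pair being coded as a one-element list.\<close>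

lemma exists_string_labels:
  fixes I :: "('u, 'u) cat" and F :: "'u \<Rightarrow> ('u, 'u) cat"
  assumes "infinite (UNIV :: 'u set)" "cat_diagram I F T"
  obtains eo :: "('u \<times> 'u) set \<Rightarrow> 'u"
    and em :: "('u \<times> 'u) set \<times> ('u \<times> 'u) list set \<times> ('u \<times> 'u) set \<Rightarrow> 'u"
  where "inj_on eo (Ob (cat_diagram.string_cat I F T))"
    "inj_on em (Mor (cat_diagram.string_cat I F T))"
proof -
  interpret cat_diagram I F T by fact
  obtain l :: "('u \<times> 'u) list \<Rightarrow> 'u" where l: "inj l"
    using exists_inj_lists[OF assms(1)] by blast
  have "Ob string_cat \<subseteq> ob_class ` ob_elements I F"
    by (auto simp: ob_elements_def elim!: colim_Ob_cases)
  then have "inj_on ((\<lambda>z. l [z]) \<circ> inv_into (ob_elements I F) ob_class) (Ob string_cat)"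
    by (intro comp_inj_on inj_on_inv_into) (auto intro!: inj_onI dest: injD[OF l])
  moreover have "inj_on (l \<circ> inv_into chains arrow) (Mor string_cat)"
    using l by (intro comp_inj_on inj_on_inv_into) (auto intro: inj_on_subset)
  ultimately show ?thesis
    by (rule that)
qed

text \<open>The two universal properties make \<open>string_cat\<close> and \<open>C\<close> isomorphic. As the universal
  property of \<open>C\<close> only concerns test categories over \<open>'u\<close>, the functor from \<open>C\<close> to
  \<open>string_cat\<close> is obtained through a copy of \<open>string_cat\<close> over \<open>'u\<close>.\<close>

lemma colimit_inverse:
  fixes I :: "('u, 'u) cat" and F :: "'u \<Rightarrow> ('u, 'u) cat"
  assumes inf: "infinite (UNIV :: 'u set)" and C: "is_colimit I F T C \<iota>"
  defines "Q \<equiv> cat_diagram.string_cat I F T" and "S \<equiv> cat_cocone.string_ftr C \<iota>"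
  obtains G where "cat_functor C Q G"
    "ftr_eq Q (ftr_comp G S) ftr_id" "ftr_eq C (ftr_comp S G) ftr_id"
proof -
  interpret cat_cocone I F T C \<iota>
    using C by (rule colimit_cocone)
  have defs: "Q = string_cat" "S = string_ftr"
    by (simp_all add: Q_def S_def)
  obtain eo :: "_ \<Rightarrow> 'u" and em :: "_ \<Rightarrow> 'u"
    where inj: "inj_on eo (Ob string_cat)" "inj_on em (Mor string_cat)"
    using exists_string_labels[OF inf cat_diagram_axioms] by blast
  obtain H where H: "cat_functor C (relabel eo em string_cat) H"
    "\<And>i. i \<in> Ob I \<Longrightarrow>
      ftr_eq (F i) (ftr_comp H (\<iota> i)) (ftr_comp (relabelling eo em) (string_leg i))"
    by (rule colimit_factor[OF C cat_cocone_labelled[OF inj]]) blast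
  let ?G = "ftr_comp (unlabelling eo em string_cat) H"
  have G: "cat_functor C string_cat ?G"
    using cat_functor_comp[OF H(1) unlabel_functor[OF inj]] .
  have leg: "ftr_eq (F i) (ftr_comp ?G (\<iota> i)) (string_leg i)" if "i \<in> Ob I" for i
    using ftr_eq_trans[OF ftr_eq_comp_left[OF H(2)[OF that]] unlabel_label_leg[OF inj that]]
    by (simp add: ftr_comp_assoc)
  have "ftr_eq string_cat (ftr_comp ?G string_ftr) ftr_id"
  proof (rule string_cat_ftr_eq[where D = string_cat])
    show "ftr_eq (F i) (ftr_comp (ftr_comp ?G string_ftr) (string_leg i))
        (ftr_comp ftr_id (string_leg i))" if "i \<in> Ob I" for i
      using ftr_eq_trans[OF ftr_eq_comp_left[OF string_ftr_leg[OF that]] leg[OF that]]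
      by (simp add: ftr_comp_assoc)
  qed (intro cat_functor_comp[OF cat_functor_string_ftr G] cat_functor_id category_string_cat)+
  \<comment> \<open>\<open>C\<close> is over \<open>'u\<close> and may serve as its own test
    category; the other round trip ends in \<open>string_cat\<close>, where uniqueness holds over
    any types.\<close>
  moreover have "ftr_eq C (ftr_comp string_ftr ?G) ftr_id"
  proof (rule colimit_ftr_eq[OF C, where D = C])
    show "ftr_eq (F i) (ftr_comp (ftr_comp string_ftr ?G) (\<iota> i)) (ftr_comp ftr_id (\<iota> i))"
      if "i \<in> Ob I" for i
      using ftr_eq_trans[OF ftr_eq_comp_left[OF leg[OF that]] string_ftr_leg[OF that]]
      by (simp add: ftr_comp_assoc)
  qed (intro cat_functor_comp[OF G cat_functor_string_ftr] cat_functor_id C.category_axioms)+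
  ultimately show ?thesis
    using that[of ?G] G by (simp add: defs)
qed

text \<open>Existence is part of the claim so that the description of all colimits is not vacuous.
  The bijection on objects identifies classes with objects of \<open>C\<close>, and
  \<open>respects\<close> is what makes \<open>class_value\<close> independent of
  representatives.\<close>

theorem corollary5p6:
  fixes I :: "('u, 'u) cat"
    and F :: "'u \<Rightarrow> ('u, 'u) cat"
    and T :: "'u \<Rightarrow> ('u, 'u, 'u, 'u) ftr"
  assumes "infinite (UNIV :: 'u set)"
    and "cat_diagram I F T"
  shows "(\<exists>C \<iota>. is_colimit I F T C \<iota>) \<and>
    (\<forall>C \<iota>. is_colimit I F T C \<iota> \<longrightarrow>
      bij_betw (class_ob \<iota>) (colim_Ob I F T) (Ob C) \<and>
      (\<forall>a \<in> colim_Ob I F T. \<forall>b \<in> colim_Ob I F T.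
        string_value C \<iota> respects string_equiv I F T a b \<and>
        bij_betw (class_value C \<iota>)
          (strings I F T a b // string_equiv I F T a b)
          (Hom C (class_ob \<iota> a) (class_ob \<iota> b))))"
proof (intro conjI allI impI ballI)
  interpret cat_diagram I F T by fact
  obtain eo :: "_ \<Rightarrow> 'u" and em :: "_ \<Rightarrow> 'u"
    where inj: "inj_on eo (Ob string_cat)" "inj_on em (Mor string_cat)"
    using exists_string_labels[OF assms] by blast
  then have "is_colimit I F T (relabel eo em string_cat)
      (\<lambda>i. ftr_comp (relabelling eo em) (string_leg i))"
    unfolding is_colimit_def
    using cat_cocone_labelled[OF inj] labelled_factor[OF inj] by blast
  then show "\<exists>C \<iota>. is_colimit I F T C \<iota>"
    by blast
next
  fix C :: "('u, 'u) cat" and \<iota> :: "'u \<Rightarrow> ('u, 'u, 'u, 'u) ftr"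
  assume C: "is_colimit I F T C \<iota>"
  interpret cat_cocone I F T C \<iota>
    using C by (rule colimit_cocone)
  obtain G where "cat_functor C string_cat G"
    "ftr_eq string_cat (ftr_comp G string_ftr) ftr_id" "ftr_eq C (ftr_comp string_ftr G) ftr_id"
    by (rule colimit_inverse[OF assms(1) C])
  note bij = inverse_functors_bij[OF cat_functor_string_ftr this]
  show "bij_betw (class_ob \<iota>) (colim_Ob I F T) (Ob C)"
    using bij(1) by (simp add: string_ftr_def)
  fix a b assume ab: "a \<in> colim_Ob I F T" "b \<in> colim_Ob I F T"
  show "string_value C \<iota> respects string_equiv I F T a b"
    using ab by (rule string_value_respects)
  let ?Q = "strings I F T a b // string_equiv I F T a b"
  \<comment> \<open>Adding the stored ends identifies the quotient with a hom-set of
    \<open>string_cat\<close>; following this by \<open>string_ftr\<close> gives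
    \<open>class_value\<close>.\<close>
  have "bij_betw (\<lambda>S. (a, S, b)) ?Q (Hom string_cat a b)"
    using ab by (simp add: string_cat_Hom bij_betw_def inj_on_def)
  then have "bij_betw (mmap string_ftr \<circ> (\<lambda>S. (a, S, b))) ?Q
      (Hom C (class_ob \<iota> a) (class_ob \<iota> b))"
    using bij(2)[of a b] ab by (intro bij_betw_trans[of _ _ "Hom string_cat a b"]) auto
  then show "bij_betw (class_value C \<iota>) ?Q (Hom C (class_ob \<iota> a) (class_ob \<iota> b))"
    by (simp add: comp_def)
qed

end
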